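(* Let $d_{w,1}$ be a Lorentz sequence space (with $p=1$) and let $T\in L(d_{w,1})$. Then $T$ is $d_{w,1}$-strictly singular if and only if $T$ is Dunford–Pettis.
   Context: Let $w=(w_n)$ be a real sequence with $w_1=1$, $w_n\downarrow 0$ and $\sum_n w_n=\infty$. The Lorentz sequence space $d_{w,1}$ is the Banach space of all $x=(x_n)\in c_0$ with $\|x\|=\sum_{n}w_n x^*_n<\infty$, where $(x^*_n)$ is the non-increasing rearrangement of $(|x_n|)$. An operator $T\in L(d_{w,1})$ is $d_{w,1}$-strictly singular if for every closed subspace $Z$ isomorphic to $d_{w,1}$, $T|_Z$ is not an isomorphism. $T$ is Dunford–Pettis if $x_n\to 0$ weakly implies $\|Tx_n\|\to 0$. *)

theory Defs
  imports "HOL-Analysis.Analysis"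
begin

text \<open>Sequences are functions nat => real, indexed from 0 (so w 0 corresponds to w_1).\<close>

definition decr_rearr :: "(nat \<Rightarrow> real) \<Rightarrow> nat \<Rightarrow> real" where
  "decr_rearr x n = Inf {s. 0 \<le> s \<and> finite {k. \<bar>x k\<bar> > s} \<and> card {k. \<bar>x k\<bar> > s} \<le> n}"

definition lorentz_norm :: "(nat \<Rightarrow> real) \<Rightarrow> (nat \<Rightarrow> real) \<Rightarrow> real" where
  "lorentz_norm w x = (\<Sum>n. w n * decr_rearr x n)"

definition dw1 :: "(nat \<Rightarrow> real) \<Rightarrow> (nat \<Rightarrow> real) set" where
  "dw1 w = {x. x \<longlonglongrightarrow> 0 \<and> summable (\<lambda>n. w n * decr_rearr x n)}"

definition lorentz_weight :: "(nat \<Rightarrow> real) \<Rightarrow> bool" where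
  "lorentz_weight w \<longleftrightarrow> w 0 = 1 \<and> decseq w \<and> w \<longlonglongrightarrow> 0 \<and> \<not> summable w"

definition linear_on_seq :: "(nat \<Rightarrow> real) set \<Rightarrow> ((nat \<Rightarrow> real) \<Rightarrow> (nat \<Rightarrow> real)) \<Rightarrow> bool" where
  "linear_on_seq D T \<longleftrightarrow>
     (\<forall>x\<in>D. \<forall>y\<in>D. \<forall>a b::real. T (\<lambda>k. a * x k + b * y k) = (\<lambda>k. a * T x k + b * T y k))"

definition linear_functional_on :: "(nat \<Rightarrow> real) set \<Rightarrow> ((nat \<Rightarrow> real) \<Rightarrow> real) \<Rightarrow> bool" where
  "linear_functional_on D f \<longleftrightarrow>
     (\<forall>x\<in>D. \<forall>y\<in>D. \<forall>a b::real. f (\<lambda>k. a * x k + b * y k) = a * f x + b * f y)"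

definition bounded_op :: "(nat \<Rightarrow> real) \<Rightarrow> ((nat \<Rightarrow> real) \<Rightarrow> (nat \<Rightarrow> real)) \<Rightarrow> bool" where
  "bounded_op w T \<longleftrightarrow> T ` dw1 w \<subseteq> dw1 w \<and> linear_on_seq (dw1 w) T \<and>
     (\<exists>C. \<forall>x\<in>dw1 w. lorentz_norm w (T x) \<le> C * lorentz_norm w x)"

definition bounded_functional :: "(nat \<Rightarrow> real) \<Rightarrow> ((nat \<Rightarrow> real) \<Rightarrow> real) \<Rightarrow> bool" where
  "bounded_functional w f \<longleftrightarrow> linear_functional_on (dw1 w) f \<and>
     (\<exists>C. \<forall>x\<in>dw1 w. \<bar>f x\<bar> \<le> C * lorentz_norm w x)"

definition weakly_null :: "(nat \<Rightarrow> real) \<Rightarrow> (nat \<Rightarrow> nat \<Rightarrow> real) \<Rightarrow> bool" where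
  "weakly_null w xs \<longleftrightarrow> (\<forall>n. xs n \<in> dw1 w) \<and>
     (\<forall>f. bounded_functional w f \<longrightarrow> (\<lambda>n. f (xs n)) \<longlonglongrightarrow> 0)"

definition dunford_pettis :: "(nat \<Rightarrow> real) \<Rightarrow> ((nat \<Rightarrow> real) \<Rightarrow> (nat \<Rightarrow> real)) \<Rightarrow> bool" where
  "dunford_pettis w T \<longleftrightarrow>
     (\<forall>xs. weakly_null w xs \<longrightarrow> (\<lambda>n. lorentz_norm w (T (xs n))) \<longlonglongrightarrow> 0)"

definition closed_subspace :: "(nat \<Rightarrow> real) \<Rightarrow> (nat \<Rightarrow> real) set \<Rightarrow> bool" where
  "closed_subspace w Z \<longleftrightarrow> Z \<subseteq> dw1 w \<and> (\<lambda>k. 0) \<in> Z \<and>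
     (\<forall>x\<in>Z. \<forall>y\<in>Z. \<forall>a b::real. (\<lambda>k. a * x k + b * y k) \<in> Z) \<and>
     (\<forall>zs z. (\<forall>n. zs n \<in> Z) \<and> z \<in> dw1 w \<and>
        (\<lambda>n. lorentz_norm w (\<lambda>k. zs n k - z k)) \<longlonglongrightarrow> 0 \<longrightarrow> z \<in> Z)"

definition iso_to_dw1 :: "(nat \<Rightarrow> real) \<Rightarrow> (nat \<Rightarrow> real) set \<Rightarrow> bool" where
  "iso_to_dw1 w Z \<longleftrightarrow> (\<exists>J c C. 0 < c \<and> bij_betw J (dw1 w) Z \<and> linear_on_seq (dw1 w) J \<and>
     (\<forall>x\<in>dw1 w. c * lorentz_norm w x \<le> lorentz_norm w (J x) \<and>
                 lorentz_norm w (J x) \<le> C * lorentz_norm w x))"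

definition iso_on :: "(nat \<Rightarrow> real) \<Rightarrow> ((nat \<Rightarrow> real) \<Rightarrow> (nat \<Rightarrow> real)) \<Rightarrow> (nat \<Rightarrow> real) set \<Rightarrow> bool" where
  "iso_on w T Z \<longleftrightarrow> (\<exists>c>0. \<forall>z\<in>Z. c * lorentz_norm w z \<le> lorentz_norm w (T z))"

definition dw1_strictly_singular :: "(nat \<Rightarrow> real) \<Rightarrow> ((nat \<Rightarrow> real) \<Rightarrow> (nat \<Rightarrow> real)) \<Rightarrow> bool" where
  "dw1_strictly_singular w T \<longleftrightarrow>
     (\<forall>Z. closed_subspace w Z \<and> iso_to_dw1 w Z \<longrightarrow> \<not> iso_on w T Z)"

end

theory Submission
  imports Defs
begin

text \<open>Both properties are equivalent to \<open>\<parallel>T e\<^sub>n\<parallel> \<rightarrow> 0\<close> for the unit vectors \<open>e\<^sub>n\<close>. The unit vector basis is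
  weakly null and its isomorphic images are again weakly null but bounded away from zero, so a
  Dunford-Pettis operator fixes no copy of the space. If \<open>\<parallel>T e\<^sub>n\<parallel>\<close> does not tend to zero, a gliding
  hump argument shows that the weakly null sequence \<open>T e\<^sub>n\<close> keeps a large coordinate; along a sparse
  subsequence \<open>T\<close> is then almost diagonal with large diagonal, hence an isomorphism on the span of
  the chosen \<open>e\<^sub>n\<close>, a copy of the whole space. If \<open>\<parallel>T e\<^sub>n\<parallel> \<rightarrow> 0\<close>, the same gliding hump lemma splits the terms of
  a weakly null sequence into boundedly many bounded coordinates, which moreover escape to infinity,
  and a remainder of small norm; \<open>T\<close> makes both parts small.\<close>

text \<open>The obstacle is that the norm of a vector may sit in very many tiny coordinates, so that
  small coordinates alone say nothing about the norm. Such flat mass is the part that survives at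
  late weights. Flat vectors behave like the basis of ell_1 along a subsequence: their masses can be
  put at disjoint stretches of weights and are then seen by one and the same functional. As in the
  proof that ell_1 has the Schur property, a weakly null sequence can therefore carry only little
  flat mass. What is left are the large coordinates, and their number is uniformly bounded because
  the weights have a divergent sum.

  The same argument yields the eventual norm bound for weakly null sequences, so the uniform
  boundedness principle is not invoked. The lower bound for \<open>T\<close> needs no projections or
  dual basis either: a placement for \<open>x\<close> is carried over, weight by weight, to the
  coordinates at which \<open>T x\<close> is large.\<close>

text \<open>The norm is handled through its dual description, as the supremum of \<open>\<Sum>k\<in>B. w (\<pi> k) * \<bar>x k\<bar>\<close>
  over finite sets \<open>B\<close> and injections \<open>\<pi>\<close>. Requiring \<open>\<pi> \<ge> p\<close> discards the \<open>p\<close> largest weights, which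
  changes the norm by at most \<open>p * sup \<bar>x k\<bar>\<close>.\<close>

definition placement :: "nat \<Rightarrow> nat set \<Rightarrow> (nat \<Rightarrow> nat) \<Rightarrow> bool" where
  "placement p B \<pi> \<longleftrightarrow> finite B \<and> inj_on \<pi> B \<and> (\<forall>k\<in>B. p \<le> \<pi> k)"

definition wsum :: "(nat \<Rightarrow> real) \<Rightarrow> nat set \<Rightarrow> (nat \<Rightarrow> nat) \<Rightarrow> (nat \<Rightarrow> real) \<Rightarrow> real" where
  "wsum w B \<pi> x = (\<Sum>k\<in>B. w (\<pi> k) * \<bar>x k\<bar>)"

section \<open>Null sequences and their decreasing rearrangements\<close>

lemma bounded_null_seq:
  fixes x :: "nat \<Rightarrow> real"
  assumes "x \<longlonglongrightarrow> 0"
  obtains M where "M \<ge> 0" "\<And>k. \<bar>x k\<bar> \<le> M"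
proof -
  have "Bseq x"
    using assms convergentI convergent_imp_Bseq by blast
  then obtain K where "K > 0" "\<And>n. norm (x n) \<le> K"
    by (auto elim: BseqE)
  then show ?thesis
    using that[of K] by auto
qed

lemma finite_superlevel:
  fixes x :: "nat \<Rightarrow> real"
  assumes "x \<longlonglongrightarrow> 0" "s > 0"
  shows "finite {k. \<bar>x k\<bar> > s}"
proof -
  obtain N where "\<And>k. k \<ge> N \<Longrightarrow> \<bar>x k\<bar> < s"
    using LIMSEQ_D[OF assms] by auto
  then have "{k. \<bar>x k\<bar> > s} \<subseteq> {..<N}"
    by (metis (mono_tags, lifting) lessThan_iff linorder_not_less mem_Collect_eq order_less_asym subsetI)
  then show ?thesis
    using finite_subset by blast
qed

lemma exists_max_outside:
  fixes x :: "nat \<Rightarrow> real"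
  assumes "x \<longlonglongrightarrow> 0" "finite F"
  shows "\<exists>k. k \<notin> F \<and> (\<forall>j. j \<notin> F \<longrightarrow> \<bar>x j\<bar> \<le> \<bar>x k\<bar>)"
proof (cases "\<exists>j. j \<notin> F \<and> x j \<noteq> 0")
  case True
  then obtain j0 where j0: "j0 \<notin> F" "\<bar>x j0\<bar> / 2 > 0" by auto
  \<comment> \<open>Half of \<open>\<bar>x j0\<bar>\<close> as threshold puts \<open>j0\<close> into
    \<open>A\<close>, while every index outside \<open>A\<close> and \<open>F\<close> is beaten by
    each element of \<open>A\<close>.\<close>
  define A where "A = {k. \<bar>x k\<bar> > \<bar>x j0\<bar> / 2} - F"
  have fin: "finite A" and ne: "j0 \<in> A"
    using finite_superlevel[OF assms(1) j0(2)] j0 by (auto simp: A_def)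
  obtain k where k: "k \<in> A" "\<And>j. j \<in> A \<Longrightarrow> \<bar>x j\<bar> \<le> \<bar>x k\<bar>"
    using ex_is_arg_min_if_finite[OF fin, of "\<lambda>k. - \<bar>x k\<bar>"] ne
    by (fastforce simp: is_arg_min_def not_less)
  have "\<bar>x j\<bar> \<le> \<bar>x k\<bar>" if "j \<notin> F" for j
  proof (cases "j \<in> A")
    case False
    then have "\<bar>x j\<bar> \<le> \<bar>x j0\<bar> / 2" using that by (auto simp: A_def)
    then show ?thesis using k(1) by (auto simp: A_def)
  qed (use k in auto)
  then show ?thesis using k(1) by (auto simp: A_def)
next
  case False
  obtain k where "k \<notin> F" using assms(2) ex_new_if_finite infinite_UNIV_nat by blast
  then show ?thesis using False by (intro exI[of _ k]) auto
qed

text \<open>Repeatedly picking a largest remaining entry produces the decreasing rearrangement entry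
  by entry. Once the support is used up, the picks are zeros, so lists of every length
  exist.\<close>

lemma greedy_list:
  fixes x :: "nat \<Rightarrow> real"
  assumes "x \<longlonglongrightarrow> 0"
  shows "\<exists>xs. distinct xs \<and> length xs = n \<and>
    (\<forall>i<n. \<forall>j. j \<notin> set (take i xs) \<longrightarrow> \<bar>x j\<bar> \<le> \<bar>x (xs ! i)\<bar>)"
proof (induction n)
  case (Suc n)
  then obtain xs where xs: "distinct xs" "length xs = n"
    "\<And>i j. i < n \<Longrightarrow> j \<notin> set (take i xs) \<Longrightarrow> \<bar>x j\<bar> \<le> \<bar>x (xs ! i)\<bar>"
    by blast
  obtain k where k: "k \<notin> set xs" "\<And>j. j \<notin> set xs \<Longrightarrow> \<bar>x j\<bar> \<le> \<bar>x k\<bar>"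
    using exists_max_outside[OF assms, of "set xs"] by auto
  have "\<bar>x j\<bar> \<le> \<bar>x ((xs @ [k]) ! i)\<bar>" if "i < Suc n" "j \<notin> set (take i (xs @ [k]))" for i j
  proof (cases "i = n")
    case True
    then show ?thesis using that k(2) xs(2) by (simp add: nth_append)
  next
    case False
    then show ?thesis using that xs(2) xs(3)[of i j] by (simp add: nth_append)
  qed
  moreover have "distinct (xs @ [k])" "length (xs @ [k]) = Suc n"
    using xs(1,2) k(1) by auto
  ultimately show ?case by blast
qed auto

text \<open>Only the first \<open>i\<close> picks can exceed the value at pick \<open>i\<close>, so
  this value is an admissible level. Any lower level is exceeded by \<open>Suc i\<close> distinct
  picks, one too many.\<close>

lemma decr_rearr_greedy:
  fixes x :: "nat \<Rightarrow> real"
  assumes d: "distinct xs" and n: "length xs = n" and i: "i < n"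
    and g: "\<And>i j. i < n \<Longrightarrow> j \<notin> set (take i xs) \<Longrightarrow> \<bar>x j\<bar> \<le> \<bar>x (xs ! i)\<bar>"
  shows "decr_rearr x i = \<bar>x (xs ! i)\<bar>"
  unfolding decr_rearr_def
proof (rule cInf_eq_minimum)
  have sub: "{k. \<bar>x (xs ! i)\<bar> < \<bar>x k\<bar>} \<subseteq> set (take i xs)"
  proof
    fix k assume "k \<in> {k. \<bar>x (xs ! i)\<bar> < \<bar>x k\<bar>}"
    then show "k \<in> set (take i xs)" using g[OF i, of k] by (cases "k \<in> set (take i xs)") simp_all
  qed
  then have "card {k. \<bar>x (xs ! i)\<bar> < \<bar>x k\<bar>} \<le> card (set (take i xs))"
    by (rule card_mono[rotated]) simp
  also have "\<dots> \<le> i"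
    using card_length[of "take i xs"] by simp
  finally show "\<bar>x (xs ! i)\<bar> \<in> {s. 0 \<le> s \<and> finite {k. s < \<bar>x k\<bar>} \<and> card {k. s < \<bar>x k\<bar>} \<le> i}"
    using finite_subset[OF sub] by simp
next
  fix s assume s: "s \<in> {s. 0 \<le> s \<and> finite {k. s < \<bar>x k\<bar>} \<and> card {k. s < \<bar>x k\<bar>} \<le> i}"
  show "\<bar>x (xs ! i)\<bar> \<le> s"
  proof (rule ccontr)
    assume neg: "\<not> \<bar>x (xs ! i)\<bar> \<le> s"
    have "set (take (Suc i) xs) \<subseteq> {k. s < \<bar>x k\<bar>}"
    proof
      fix k assume "k \<in> set (take (Suc i) xs)"
      then obtain l where "l < length (take (Suc i) xs)" "k = take (Suc i) xs ! l"
        unfolding in_set_conv_nth by blast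
      then have l: "l \<le> i" "k = xs ! l" by simp_all
      have "xs ! i \<notin> set (take l xs)"
      proof (rule notI)
        assume "xs ! i \<in> set (take l xs)"
        then obtain j where "j < l" "xs ! j = xs ! i" using l(1) i n by (auto simp: in_set_conv_nth)
        then show False using nth_eq_iff_index_eq[OF d, of j i] l(1) i n by simp
      qed
      then have "\<bar>x (xs ! i)\<bar> \<le> \<bar>x k\<bar>" using g[of l "xs ! i"] l i by simp
      then show "k \<in> {k. s < \<bar>x k\<bar>}" using neg by auto
    qed
    then have "card (set (take (Suc i) xs)) \<le> i"
      using s card_mono[of "{k. s < \<bar>x k\<bar>}" "set (take (Suc i) xs)"] by simp
    moreover have "card (set (take (Suc i) xs)) = Suc i"
      using d n i by (simp add: distinct_card)
    ultimately show False by simp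
  qed
qed

lemma decr_rearr_nonneg:
  assumes "x \<longlonglongrightarrow> 0" shows "0 \<le> decr_rearr x i"
proof -
  obtain xs where xs: "distinct xs" "length xs = Suc i"
    "\<forall>l<Suc i. \<forall>j. j \<notin> set (take l xs) \<longrightarrow> \<bar>x j\<bar> \<le> \<bar>x (xs ! l)\<bar>"
    using greedy_list[OF assms, of "Suc i"] by blast
  have "decr_rearr x i = \<bar>x (xs ! i)\<bar>"
    by (rule decr_rearr_greedy[OF xs(1,2)]) (use xs(3) in auto)
  then show ?thesis by simp
qed

lemma decr_rearr_ge:
  assumes "x \<longlonglongrightarrow> 0" "finite A" "card A > i" "\<And>k. k \<in> A \<Longrightarrow> t \<le> \<bar>x k\<bar>"
  shows "t \<le> decr_rearr x i"
  unfolding decr_rearr_def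
proof (rule cInf_greatest)
  obtain M where "M \<ge> 0" "\<And>k. \<bar>x k\<bar> \<le> M" using bounded_null_seq[OF assms(1)] by auto
  then have "{k. \<bar>x k\<bar> > M} = {}" by (auto simp: not_less)
  with \<open>M \<ge> 0\<close> have "M \<in> {s. 0 \<le> s \<and> finite {k. s < \<bar>x k\<bar>} \<and> card {k. s < \<bar>x k\<bar>} \<le> i}"
    by simp
  then show "{s. 0 \<le> s \<and> finite {k. s < \<bar>x k\<bar>} \<and> card {k. s < \<bar>x k\<bar>} \<le> i} \<noteq> {}"
    by blast
next
  fix s assume s: "s \<in> {s. 0 \<le> s \<and> finite {k. s < \<bar>x k\<bar>} \<and> card {k. s < \<bar>x k\<bar>} \<le> i}"
  show "t \<le> s"
  proof (rule ccontr)
    assume "\<not> t \<le> s"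
    then have "A \<subseteq> {k. s < \<bar>x k\<bar>}" using assms(4) by force
    then have "card A \<le> i" using s card_mono[of "{k. s < \<bar>x k\<bar>}" A] by auto
    then show False using assms(3) by simp
  qed
qed

section \<open>Rearrangement inequality and placements\<close>

lemma sum_decseq_le_initial:
  fixes w :: "nat \<Rightarrow> real"
  assumes "decseq w" "finite S"
  shows "sum w S \<le> sum w {..<card S}"
  using assms(2)
proof (induction S rule: finite_linorder_max_induct)
  case (insert b A)
  \<comment> \<open>All \<open>card A\<close> other elements lie below \<open>b\<close>, so
    \<open>b\<close> is at least \<open>card A\<close>, the index by which the initial segment
    grows.\<close>
  have "A \<subseteq> {..<b}" using insert by auto
  then have "card A \<le> b" using card_mono[of "{..<b}" A] by simp
  then have "w b \<le> w (card A)" using assms(1) by (simp add: decseq_def)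
  moreover have "b \<notin> A" using insert by auto
  ultimately show ?case using insert by simp
qed simp

text \<open>Summation by parts as an induction: the partial sum over \<open>i < Suc n\<close> is
  nonnegative, so lowering its coefficient from \<open>a n\<close> to \<open>a (Suc n)\<close> can
  only decrease it.\<close>

lemma abel_sum_ge:
  fixes a d :: "nat \<Rightarrow> real"
  assumes "\<And>i. i < n \<Longrightarrow> a (Suc i) \<le> a i" "\<And>m. m \<le> Suc n \<Longrightarrow> 0 \<le> (\<Sum>i<m. d i)"
  shows "a n * (\<Sum>i<Suc n. d i) \<le> (\<Sum>i<Suc n. a i * d i)"
  using assms
proof (induction n)
  case (Suc n)
  have "a (Suc n) * (\<Sum>i<Suc n. d i) \<le> a n * (\<Sum>i<Suc n. d i)"
    using Suc.prems(1)[of n] Suc.prems(2)[of "Suc n"] by (intro mult_right_mono) auto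
  also have "\<dots> \<le> (\<Sum>i<Suc n. a i * d i)"
    using Suc.prems by (intro Suc.IH) auto
  finally show ?case
    by (simp add: distrib_left)
qed simp

text \<open>\<open>\<rho>\<close> is merely an injection, since a placement may skip weights. Any
  \<open>l\<close> distinct weights sum to at most the first \<open>l\<close>, and Abel summation
  against the decreasing \<open>a\<close> carries this over to the weighted sums.\<close>

lemma rearrangement_le:
  fixes w a :: "nat \<Rightarrow> real"
  assumes "decseq w" "inj_on \<rho> {..<n}" "\<And>i. Suc i < n \<Longrightarrow> a (Suc i) \<le> a i" "\<And>i. i < n \<Longrightarrow> 0 \<le> a i"
  shows "(\<Sum>i<n. w (\<rho> i) * a i) \<le> (\<Sum>i<n. w i * a i)"
proof (cases n)
  case (Suc m)
  define d where "d i = w i - w (\<rho> i)" for i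
  have D: "0 \<le> (\<Sum>i<l. d i)" if "l \<le> n" for l
  proof -
    have inj: "inj_on \<rho> {..<l}" using assms(2) that by (auto intro: inj_on_subset)
    have "(\<Sum>i<l. w (\<rho> i)) = sum w (\<rho> ` {..<l})" by (simp add: sum.reindex[OF inj])
    also have "\<dots> \<le> sum w {..<card (\<rho> ` {..<l})}"
      by (intro sum_decseq_le_initial assms) auto
    also have "card (\<rho> ` {..<l}) = l" using card_image[OF inj] by simp
    finally show ?thesis by (simp add: d_def sum_subtractf)
  qed
  have "0 \<le> a m * (\<Sum>i<Suc m. d i)" using D[of "Suc m"] Suc assms(4)[of m] by (intro mult_nonneg_nonneg) auto
  also have "\<dots> \<le> (\<Sum>i<Suc m. a i * d i)" using D assms(3) Suc by (intro abel_sum_ge) auto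
  finally show ?thesis using Suc by (simp add: d_def sum_subtractf algebra_simps)
qed simp

text \<open>Sort \<open>B\<close> by decreasing \<open>\<bar>x k\<bar>\<close>. The rearrangement
  inequality moves the weights to the initial ones, and since \<open>Suc i\<close> indices carry at
  least the \<open>i\<close>-th sorted value, \<open>decr_rearr x i\<close> dominates it.\<close>

lemma wsum_le_decr_rearr:
  fixes w x :: "nat \<Rightarrow> real"
  assumes w: "decseq w" "\<And>n. 0 \<le> w n" and x: "x \<longlonglongrightarrow> 0" and B: "placement p B \<pi>"
  shows "wsum w B \<pi> x \<le> (\<Sum>i<card B. w i * decr_rearr x i)"
proof -
  define bs where "bs = sort_key (\<lambda>k. - \<bar>x k\<bar>) (sorted_list_of_set B)"
  define n where "n = card B"
  have finB: "finite B" and injB: "inj_on \<pi> B" using B by (auto simp: placement_def)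
  have d: "distinct bs" and set: "set bs = B" and len: "length bs = n"
    using finB by (auto simp: bs_def n_def)
  have sorted: "sorted (map (\<lambda>k. - \<bar>x k\<bar>) bs)" by (simp add: bs_def)
  have mono: "\<bar>x (bs ! j)\<bar> \<le> \<bar>x (bs ! i)\<bar>" if "i \<le> j" "j < n" for i j
    using sorted_nth_mono[OF sorted that(1)] that len by simp
  have bij: "bij_betw ((!) bs) {..<n} B"
    using d set len bij_betw_nth by blast
  have "wsum w B \<pi> x = (\<Sum>i<n. w (\<pi> (bs ! i)) * \<bar>x (bs ! i)\<bar>)"
    unfolding wsum_def by (rule sum.reindex_bij_betw[OF bij, symmetric])
  also have "\<dots> \<le> (\<Sum>i<n. w i * \<bar>x (bs ! i)\<bar>)"
  proof (rule rearrangement_le[OF w(1)])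
    show "inj_on (\<lambda>i. \<pi> (bs ! i)) {..<n}"
      using comp_inj_on[of "(!) bs" "{..<n}" \<pi>] bij injB by (auto simp: bij_betw_def comp_def)
  qed (use mono in auto)
  also have "\<dots> \<le> (\<Sum>i<n. w i * decr_rearr x i)"
  proof (rule sum_mono, rule mult_left_mono)
    fix i assume i: "i \<in> {..<n}"
    show "\<bar>x (bs ! i)\<bar> \<le> decr_rearr x i"
    proof (rule decr_rearr_ge[OF x, where A = "set (take (Suc i) bs)"])
      show "i < card (set (take (Suc i) bs))" using d i len by (simp add: distinct_card)
      fix k assume "k \<in> set (take (Suc i) bs)"
      then show "\<bar>x (bs ! i)\<bar> \<le> \<bar>x k\<bar>"
        using i len mono by (auto simp: in_set_conv_nth)
    qed simp
  qed (use w in auto)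
  finally show ?thesis by (simp add: n_def)
qed

text \<open>The upper bound for placements is attained: on the greedy list, let \<open>\<pi>\<close>
  send each index to its position.\<close>

lemma decr_rearr_sum_as_wsum:
  fixes w x :: "nat \<Rightarrow> real"
  assumes "x \<longlonglongrightarrow> 0"
  shows "\<exists>B \<pi>. placement 0 B \<pi> \<and> (\<Sum>i<n. w i * decr_rearr x i) = wsum w B \<pi> x"
proof -
  obtain xs where xs: "distinct xs" "length xs = n"
    "\<And>i j. i < n \<Longrightarrow> j \<notin> set (take i xs) \<Longrightarrow> \<bar>x j\<bar> \<le> \<bar>x (xs ! i)\<bar>"
    using greedy_list[OF assms, of n] by blast
  have bij: "bij_betw ((!) xs) {..<n} (set xs)" using xs bij_betw_nth by blast
  define \<pi> where "\<pi> = inv_into {..<n} ((!) xs)"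
  have "bij_betw \<pi> (set xs) {..<n}" unfolding \<pi>_def by (rule bij_betw_inv_into[OF bij])
  then have pl: "placement 0 (set xs) \<pi>" by (auto simp: placement_def bij_betw_def)
  have "wsum w (set xs) \<pi> x = (\<Sum>i<n. w (\<pi> (xs ! i)) * \<bar>x (xs ! i)\<bar>)"
    unfolding wsum_def by (rule sum.reindex_bij_betw[OF bij, symmetric])
  also have "\<dots> = (\<Sum>i<n. w i * decr_rearr x i)"
  proof (rule sum.cong)
    fix i assume i: "i \<in> {..<n}"
    have "\<pi> (xs ! i) = i" unfolding \<pi>_def
      using bij i by (auto simp: bij_betw_def inv_into_f_f)
    then show "w (\<pi> (xs ! i)) * \<bar>x (xs ! i)\<bar> = w i * decr_rearr x i"
      using decr_rearr_greedy[of xs n i x] xs i by auto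
  qed simp
  finally show ?thesis using pl by metis
qed

lemma placement_mono: "placement q B \<pi> \<Longrightarrow> p \<le> q \<Longrightarrow> placement p B \<pi>"
  by (auto simp: placement_def)

lemma placement_subset: "placement p B \<pi> \<Longrightarrow> A \<subseteq> B \<Longrightarrow> placement p A \<pi>"
  by (auto simp: placement_def intro: finite_subset inj_on_subset)

lemma placement_single: "placement p {k} (\<lambda>_. p)"
  by (simp add: placement_def)

lemma wsum_single [simp]: "wsum w {k} \<pi> x = w (\<pi> k) * \<bar>x k\<bar>"
  by (simp add: wsum_def)

lemma wsum_union:
  assumes "finite A" "finite B" "A \<inter> B = {}"
  shows "wsum w (A \<union> B) \<pi> x = wsum w A \<pi> x + wsum w B \<pi> x"
  unfolding wsum_def by (rule sum.union_disjoint[OF assms])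

lemma linear_functional_onD:
  assumes "linear_functional_on D f" "x \<in> D" "y \<in> D"
  shows "f (\<lambda>k. a * x k + b * y k) = a * f x + b * f y"
  using assms by (auto simp: linear_functional_on_def)

definition unit_seq :: "nat \<Rightarrow> nat \<Rightarrow> real" where
  "unit_seq n = (\<lambda>k. if k = n then 1 else 0)"

text \<open>For injective \<open>\<kappa>\<close> this moves \<open>unit_seq j\<close> to
  \<open>unit_seq (\<kappa> j)\<close>. It serves as the isomorphism onto the sequences supported on
  \<open>range \<kappa>\<close>.\<close>

definition spread :: "(nat \<Rightarrow> nat) \<Rightarrow> (nat \<Rightarrow> real) \<Rightarrow> nat \<Rightarrow> real" where
  "spread \<kappa> x i = (if i \<in> range \<kappa> then x (inv \<kappa> i) else 0)"

lemma spread_apply [simp]: "inj \<kappa> \<Longrightarrow> spread \<kappa> x (\<kappa> j) = x j"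
  by (simp add: spread_def)

lemma sum_half_powers_le: "finite F \<Longrightarrow> (\<Sum>i\<in>F. (1/2::real) ^ i) \<le> 2"
  using sum_le_suminf[of "\<lambda>i. (1/2::real) ^ i" F] summable_geometric[of "1/2::real"]
    suminf_geometric[of "1/2::real"] by simp

section \<open>The Lorentz norm and its tails\<close>

locale lorentz_sequence_space =
  fixes w :: "nat \<Rightarrow> real"
  assumes weight: "lorentz_weight w"
begin

lemma decseq_w: "decseq w" and w_0: "w 0 = 1" and w_tendsto: "w \<longlonglongrightarrow> 0"
  and not_summable_w: "\<not> summable w"
  using weight by (auto simp: lorentz_weight_def)

lemma w_nonneg: "0 \<le> w n"
  using decseq_ge[OF decseq_w w_tendsto] .

lemma w_le_one: "w n \<le> 1"
  using decseqD[OF decseq_w, of 0 n] w_0 by simp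

lemma w_pos: "0 < w n"
proof (rule ccontr)
  assume "\<not> 0 < w n"
  then have z: "w k = 0" if "k \<ge> n" for k
    using w_nonneg[of k] decseqD[OF decseq_w that] by simp
  have "summable w" by (rule summable_finite[of "{..<n}"]) (use z in auto)
  then show False using not_summable_w by simp
qed

lemma w_sums_unbounded: "\<exists>n. (\<Sum>i<n. w i) > c"
proof (rule ccontr)
  assume "\<not> ?thesis"
  then have "summable w"
    by (intro summableI_nonneg_bounded[where x = c]) (auto simp: w_nonneg not_less)
  then show False using not_summable_w by simp
qed

lemma dw1_tendsto: "x \<in> dw1 w \<Longrightarrow> x \<longlonglongrightarrow> 0"
  by (simp add: dw1_def)

lemma wsum_le_norm:
  assumes "x \<in> dw1 w" "placement p B \<pi>"
  shows "wsum w B \<pi> x \<le> lorentz_norm w x"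
proof -
  have "wsum w B \<pi> x \<le> (\<Sum>i<card B. w i * decr_rearr x i)"
    using wsum_le_decr_rearr[OF decseq_w w_nonneg dw1_tendsto assms(2)] assms(1) .
  also have "\<dots> \<le> lorentz_norm w x"
    unfolding lorentz_norm_def
    using assms(1) decr_rearr_nonneg[OF dw1_tendsto] w_nonneg
    by (intro sum_le_suminf) (auto simp: dw1_def)
  finally show ?thesis .
qed

text \<open>Together with \<open>wsum_le_norm\<close> this makes the norm a supremum of sums with
  nonnegative weights. Monotonicity and the triangle inequality then hold termwise, without arguing
  about \<open>decr_rearr\<close>.\<close>

lemma
  assumes x: "x \<longlonglongrightarrow> 0" and C: "\<And>B \<pi>. placement 0 B \<pi> \<Longrightarrow> wsum w B \<pi> x \<le> C"
  shows dw1I: "x \<in> dw1 w" and norm_leI: "lorentz_norm w x \<le> C"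
proof -
  have le: "(\<Sum>i<n. w i * decr_rearr x i) \<le> C" for n
    using decr_rearr_sum_as_wsum[OF x, where w = w and n = n] C by metis
  then have "summable (\<lambda>i. w i * decr_rearr x i)"
    using decr_rearr_nonneg[OF x] w_nonneg by (intro summableI_nonneg_bounded[where x = C]) auto
  then show "x \<in> dw1 w" "lorentz_norm w x \<le> C"
    using x le by (auto simp: dw1_def lorentz_norm_def intro: suminf_le_const)
qed

lemma wsum_approx:
  assumes "x \<in> dw1 w" "\<epsilon> > 0"
  obtains B \<pi> where "placement 0 B \<pi>" "lorentz_norm w x - \<epsilon> < wsum w B \<pi> x"
proof -
  have "\<exists>B \<pi>. placement 0 B \<pi> \<and> lorentz_norm w x - \<epsilon> < wsum w B \<pi> x"
    using norm_leI[OF dw1_tendsto[OF assms(1)], of "lorentz_norm w x - \<epsilon>"] assms(2) by force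
  then show ?thesis using that by blast
qed

lemma norm_nonneg: "x \<in> dw1 w \<Longrightarrow> 0 \<le> lorentz_norm w x"
  using wsum_le_norm[of x 0 "{}" id] by (simp add: placement_def wsum_def)

lemma abs_le_norm: "x \<in> dw1 w \<Longrightarrow> \<bar>x k\<bar> \<le> lorentz_norm w x"
  using wsum_le_norm[OF _ placement_single[of 0 k], of x] by (simp add: w_0)

lemma dw1_mono:
  assumes "x \<in> dw1 w" "\<And>k. \<bar>y k\<bar> \<le> \<bar>x k\<bar>"
  shows "y \<in> dw1 w"
proof (rule dw1I)
  show "y \<longlonglongrightarrow> 0"
    by (rule Lim_null_comparison[OF _ tendsto_rabs_zero[OF dw1_tendsto[OF assms(1)]]])
      (use assms(2) in auto)
  fix B \<pi> assume pl: "placement 0 B \<pi>"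
  have "wsum w B \<pi> y \<le> wsum w B \<pi> x"
    unfolding wsum_def by (intro sum_mono mult_left_mono assms w_nonneg)
  then show "wsum w B \<pi> y \<le> lorentz_norm w x" using wsum_le_norm[OF assms(1) pl] by simp
qed

lemma
  assumes x: "x \<in> dw1 w" and y: "y \<in> dw1 w"
  shows dw1_lincomb: "(\<lambda>k. a * x k + b * y k) \<in> dw1 w"
    and norm_lincomb: "lorentz_norm w (\<lambda>k. a * x k + b * y k)
      \<le> \<bar>a\<bar> * lorentz_norm w x + \<bar>b\<bar> * lorentz_norm w y"
proof -
  let ?z = "\<lambda>k. a * x k + b * y k"
  have z: "?z \<longlonglongrightarrow> 0"
    using tendsto_add[OF tendsto_mult_right_zero[OF dw1_tendsto[OF x], of a]
        tendsto_mult_right_zero[OF dw1_tendsto[OF y], of b]] by simp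
  have "wsum w B \<pi> ?z \<le> \<bar>a\<bar> * lorentz_norm w x + \<bar>b\<bar> * lorentz_norm w y" if "placement 0 B \<pi>" for B \<pi>
  proof -
    have "wsum w B \<pi> ?z \<le> (\<Sum>k\<in>B. w (\<pi> k) * (\<bar>a\<bar> * \<bar>x k\<bar> + \<bar>b\<bar> * \<bar>y k\<bar>))"
      unfolding wsum_def
      by (intro sum_mono mult_left_mono w_nonneg order_trans[OF abs_triangle_ineq]) (simp add: abs_mult)
    also have "\<dots> = \<bar>a\<bar> * wsum w B \<pi> x + \<bar>b\<bar> * wsum w B \<pi> y"
      by (simp add: wsum_def sum_distrib_left sum.distrib algebra_simps)
    also have "\<dots> \<le> \<bar>a\<bar> * lorentz_norm w x + \<bar>b\<bar> * lorentz_norm w y"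
      by (intro add_mono mult_left_mono wsum_le_norm[OF x that] wsum_le_norm[OF y that]) auto
    finally show ?thesis .
  qed
  then show "?z \<in> dw1 w" 
      "lorentz_norm w ?z \<le> \<bar>a\<bar> * lorentz_norm w x + \<bar>b\<bar> * lorentz_norm w y"
    using dw1I[OF z] norm_leI[OF z] by blast+
qed

lemma norm_triangle:
  assumes "x \<in> dw1 w" "y \<in> dw1 w" "\<And>k. z k = x k + y k"
  shows "lorentz_norm w z \<le> lorentz_norm w x + lorentz_norm w y"
proof -
  have "z = (\<lambda>k. 1 * x k + 1 * y k)" using assms(3) by auto
  then show ?thesis using norm_lincomb[OF assms(1,2), of 1 1] by simp
qed

lemma zero_in_dw1: "(\<lambda>k. 0) \<in> dw1 w"
  by (rule dw1I[of _ 0]) (auto simp: wsum_def)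

lemma norm_zero: "lorentz_norm w (\<lambda>k. 0) = 0"
proof (rule antisym)
  show "lorentz_norm w (\<lambda>k. 0) \<le> 0" by (rule norm_leI) (auto simp: wsum_def)
qed (rule norm_nonneg[OF zero_in_dw1])

lemma
  assumes F: "finite F" "\<And>i. i \<in> F \<Longrightarrow> X i \<in> dw1 w"
  shows dw1_sum: "(\<lambda>k. \<Sum>i\<in>F. a i * X i k) \<in> dw1 w"
    and norm_sum: "lorentz_norm w (\<lambda>k. \<Sum>i\<in>F. a i * X i k) \<le> (\<Sum>i\<in>F. \<bar>a i\<bar> * lorentz_norm w (X i))"
proof -
  have "(\<lambda>k. \<Sum>i\<in>F. a i * X i k) \<in> dw1 w \<and>
    lorentz_norm w (\<lambda>k. \<Sum>i\<in>F. a i * X i k) \<le> (\<Sum>i\<in>F. \<bar>a i\<bar> * lorentz_norm w (X i))"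
    using F
  proof (induction F)
    case empty
    then show ?case by (simp add: zero_in_dw1 norm_zero)
  next
    case (insert j F)
    let ?y = "\<lambda>k. \<Sum>i\<in>F. a i * X i k"
    have eq: "(\<lambda>k. \<Sum>i\<in>insert j F. a i * X i k) = (\<lambda>k. a j * X j k + 1 * ?y k)"
      using insert by simp
    show ?case unfolding eq
      using insert dw1_lincomb[of "X j" ?y "a j" 1] norm_lincomb[of "X j" ?y "a j" 1] by simp
  qed
  then show "(\<lambda>k. \<Sum>i\<in>F. a i * X i k) \<in> dw1 w"
    "lorentz_norm w (\<lambda>k. \<Sum>i\<in>F. a i * X i k) \<le> (\<Sum>i\<in>F. \<bar>a i\<bar> * lorentz_norm w (X i))"
    by auto
qed

text \<open>Take a placement attaining the norm up to \<open>\<epsilon>/2\<close>. A placement at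
  later weights can be joined to it on the indices outside \<open>B0\<close>, and the joint sum
  cannot exceed the norm, so these indices add at most \<open>\<epsilon>/2\<close>. The indices in
  \<open>B0\<close> now meet only weights up to \<open>w p\<close>.\<close>

lemma small_beyond:
  assumes x: "x \<in> dw1 w" and e: "\<epsilon> > 0"
  obtains p where "\<And>q B \<pi>. q \<ge> p \<Longrightarrow> placement q B \<pi> \<Longrightarrow> wsum w B \<pi> x \<le> \<epsilon>"
proof -
  obtain B0 \<pi>0 where B0: "placement 0 B0 \<pi>0" "lorentz_norm w x - \<epsilon>/2 < wsum w B0 \<pi>0 x"
    using wsum_approx[OF x, of "\<epsilon>/2"] e by auto
  have fin0: "finite B0" using B0 by (simp add: placement_def)
  define S where "S = (\<Sum>k\<in>B0. \<bar>x k\<bar>)"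
  have S: "S \<ge> 0" by (simp add: S_def sum_nonneg)
  \<comment> \<open>\<open>p\<close> must lie beyond all weights used by \<open>\<pi>0\<close>,
    which keeps the joined placement injective, and must make \<open>w p * S\<close> at most
    \<open>\<epsilon>/2\<close>. The summand 1 guards against \<open>S = 0\<close>.\<close>
  have "eventually (\<lambda>n. w n < \<epsilon> / (2 * (S + 1))) sequentially"
    using order_tendstoD(2)[OF w_tendsto, of "\<epsilon> / (2 * (S + 1))"] S e by simp
  moreover have "eventually (\<lambda>n. n > Max (insert 0 (\<pi>0 ` B0))) sequentially"
    by (rule eventually_gt_at_top)
  ultimately obtain p where p: "w p < \<epsilon> / (2 * (S + 1))" "p > Max (insert 0 (\<pi>0 ` B0))"
    by (metis (mono_tags, lifting) eventually_conj eventually_sequentially order_refl)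
  have p0: "\<pi>0 k < p" if "k \<in> B0" for k
    using p(2) that fin0 by simp
  have "wsum w B \<pi> x \<le> \<epsilon>" if pl: "placement p B \<pi>" for B \<pi>
  proof -
    have finB: "finite B" using pl by (simp add: placement_def)
    define \<rho> where "\<rho> k = (if k \<in> B0 then \<pi>0 k else \<pi> k)" for k
    have "inj_on \<rho> (B0 \<union> (B - B0))"
    proof (rule inj_onI)
      fix k l assume kl: "k \<in> B0 \<union> (B - B0)" "l \<in> B0 \<union> (B - B0)" "\<rho> k = \<rho> l"
      have a: "\<pi>0 i \<noteq> \<pi> j" if "i \<in> B0" "j \<in> B" for i j
        using p0[OF that(1)] pl that(2) by (fastforce simp: placement_def)
      show "k = l"
        using kl a[of k l] a[of l k] B0(1) pl 
        by (auto simp: \<rho>_def placement_def dest: inj_onD split: if_splits)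
    qed
    then have "placement 0 (B0 \<union> (B - B0)) \<rho>"
      using fin0 finB by (simp add: placement_def)
    then have "wsum w (B0 \<union> (B - B0)) \<rho> x \<le> lorentz_norm w x"
      by (rule wsum_le_norm[OF x])
    moreover have "wsum w (B0 \<union> (B - B0)) \<rho> x = wsum w B0 \<rho> x + wsum w (B - B0) \<rho> x"
      using fin0 finB by (intro wsum_union) auto
    moreover have "wsum w B0 \<rho> x = wsum w B0 \<pi>0 x" "wsum w (B - B0) \<rho> x = wsum w (B - B0) \<pi> x"
      unfolding wsum_def by (auto intro!: sum.cong simp: \<rho>_def)
    ultimately have 1: "wsum w (B - B0) \<pi> x \<le> \<epsilon>/2" using B0(2) by simp
    have "wsum w (B \<inter> B0) \<pi> x \<le> (\<Sum>k\<in>B \<inter> B0. w p * \<bar>x k\<bar>)"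
      unfolding wsum_def using pl decseqD[OF decseq_w]
      by (intro sum_mono mult_right_mono) (auto simp: placement_def)
    also have "\<dots> \<le> w p * S"
      unfolding S_def sum_distrib_left using fin0 w_nonneg by (intro sum_mono2) auto
    also have "\<dots> \<le> \<epsilon> / (2 * (S + 1)) * (S + 1)"
      using p(1) S e by (intro mult_mono) auto
    also have "\<dots> = \<epsilon>/2" using S by (simp add: field_simps)
    finally have 2: "wsum w (B \<inter> B0) \<pi> x \<le> \<epsilon>/2" .
    have "wsum w ((B \<inter> B0) \<union> (B - B0)) \<pi> x = wsum w (B \<inter> B0) \<pi> x + wsum w (B - B0) \<pi> x"
      using fin0 finB by (intro wsum_union) auto
    moreover have "(B \<inter> B0) \<union> (B - B0) = B" by auto
    ultimately show ?thesis using 1 2 by simp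
  qed
  then show ?thesis using that[of p] placement_mono by blast
qed

lemma norm_le_sup_plus:
  assumes x: "x \<in> dw1 w" and \<eta>: "\<And>k. \<bar>x k\<bar> \<le> \<eta>"
    and d: "\<And>B \<pi>. placement p B \<pi> \<Longrightarrow> wsum w B \<pi> x \<le> \<delta>"
  shows "lorentz_norm w x \<le> p * \<eta> + \<delta>"
proof (rule norm_leI[OF dw1_tendsto[OF x]])
  fix B \<pi> assume pl: "placement 0 B \<pi>"
  define B1 where "B1 = {k \<in> B. \<pi> k < p}"
  define B2 where "B2 = {k \<in> B. p \<le> \<pi> k}"
  have fin: "finite B1" "finite B2" and eq: "B = B1 \<union> B2" "B1 \<inter> B2 = {}"
    using pl by (auto simp: B1_def B2_def placement_def)
  have \<eta>0: "0 \<le> \<eta>" using \<eta>[of 0] by linarith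
  have "inj_on \<pi> B1" using pl by (auto simp: B1_def placement_def intro: inj_on_subset)
  then have "card B1 = card (\<pi> ` B1)" by (simp add: card_image)
  also have "\<dots> \<le> card {..<p}" by (intro card_mono) (auto simp: B1_def)
  finally have card: "card B1 \<le> p" by simp
  have "wsum w B1 \<pi> x \<le> (\<Sum>k\<in>B1. 1 * \<eta>)"
    unfolding wsum_def using w_nonneg w_le_one \<eta> \<eta>0 by (intro sum_mono mult_mono) auto
  also have "\<dots> \<le> p * \<eta>" using card \<eta>0 by (simp add: mult_right_mono)
  finally have "wsum w B1 \<pi> x \<le> p * \<eta>" .
  moreover have "wsum w B2 \<pi> x \<le> \<delta>"
    using pl by (intro d) (auto simp: B2_def placement_def intro: inj_on_subset)
  moreover have "wsum w B \<pi> x = wsum w B1 \<pi> x + wsum w B2 \<pi> x"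
    using wsum_union[OF fin eq(2)] eq(1) by simp
  ultimately show "wsum w B \<pi> x \<le> p * \<eta> + \<delta>" by simp
qed

text \<open>Finitely supported sequences are dense: cutting off a long head leaves coordinates of
  size at most \<open>\<eta>\<close>, so the first \<open>p\<close> weights cost at most
  \<open>\<epsilon>/2\<close>, and \<open>small_beyond\<close> bounds the rest.\<close>

lemma norm_tail_small:
  assumes x: "x \<in> dw1 w" and e: "\<epsilon> > 0"
  obtains N where "lorentz_norm w (\<lambda>k. if k < N then 0 else x k) \<le> \<epsilon>"
proof -
  obtain p where p: "\<And>B \<pi>. placement p B \<pi> \<Longrightarrow> wsum w B \<pi> x \<le> \<epsilon>/2"
    using small_beyond[OF x, of "\<epsilon>/2"] e by (metis half_gt_zero order_refl)
  define \<eta> where "\<eta> = \<epsilon> / (2 * (real p + 1))"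
  have \<eta>: "\<eta> > 0" using e by (simp add: \<eta>_def)
  obtain N where N: "\<And>k. k \<ge> N \<Longrightarrow> \<bar>x k\<bar> < \<eta>"
    using LIMSEQ_D[OF dw1_tendsto[OF x] \<eta>] by auto
  let ?y = "\<lambda>k. if k < N then 0 else x k"
  have y: "?y \<in> dw1 w" by (rule dw1_mono[OF x]) auto
  have "lorentz_norm w ?y \<le> p * \<eta> + \<epsilon>/2"
  proof (rule norm_le_sup_plus[OF y])
    fix k show "\<bar>?y k\<bar> \<le> \<eta>" using N[of k] \<eta> by (cases "k < N") auto
  next
    fix B \<pi> assume "placement p B \<pi>"
    then have "wsum w B \<pi> x \<le> \<epsilon>/2" by (rule p)
    moreover have "wsum w B \<pi> ?y \<le> wsum w B \<pi> x"
      unfolding wsum_def by (intro sum_mono mult_left_mono w_nonneg) auto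
    ultimately show "wsum w B \<pi> ?y \<le> \<epsilon>/2" by simp
  qed
  also have "p * \<eta> \<le> (real p + 1) * \<eta>" using \<eta> by simp
  also have "(real p + 1) * \<eta> = \<epsilon>/2" by (simp add: \<eta>_def field_simps)
  finally show ?thesis using that[of N] by simp
qed

section \<open>Unit vectors, bounded functionals and weak convergence\<close>

lemma unit_in_dw1: "unit_seq n \<in> dw1 w" and norm_unit: "lorentz_norm w (unit_seq n) = 1"
proof -
  have lim: "unit_seq n \<longlonglongrightarrow> 0"
    by (rule tendsto_eventually) (auto simp: unit_seq_def eventually_at_top_dense)
  have le: "wsum w B \<pi> (unit_seq n) \<le> 1" if "placement 0 B \<pi>" for B \<pi>
  proof -
    have "wsum w B \<pi> (unit_seq n) = (\<Sum>k\<in>B. if k = n then w (\<pi> n) else 0)"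
      unfolding wsum_def unit_seq_def by (intro sum.cong) auto
    also have "\<dots> \<le> 1" using that w_le_one by (auto simp: placement_def)
    finally show ?thesis .
  qed
  show e: "unit_seq n \<in> dw1 w" using dw1I[OF lim] le by blast
  have "lorentz_norm w (unit_seq n) \<le> 1" using norm_leI[OF lim] le by blast
  moreover have "1 \<le> lorentz_norm w (unit_seq n)"
    using abs_le_norm[OF e, of n] by (simp add: unit_seq_def)
  ultimately show "lorentz_norm w (unit_seq n) = 1" by simp
qed

lemma functional_sum:
  assumes f: "linear_functional_on (dw1 w) f" and "finite F" "\<And>i. i \<in> F \<Longrightarrow> X i \<in> dw1 w"
  shows "f (\<lambda>k. \<Sum>i\<in>F. a i * X i k) = (\<Sum>i\<in>F. a i * f (X i))"
  using assms(2,3)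
proof (induction F)
  case empty
  show ?case using linear_functional_onD[OF f zero_in_dw1 zero_in_dw1, of 0 0] by simp
next
  case (insert j F)
  have "f (\<lambda>k. a j * X j k + 1 * (\<Sum>i\<in>F. a i * X i k))
      = a j * f (X j) + 1 * f (\<lambda>k. \<Sum>i\<in>F. a i * X i k)"
    using insert by (intro linear_functional_onD[OF f] dw1_sum) auto
  then show ?case using insert by simp
qed

lemma linear_on_seq_sum:
  assumes T: "linear_on_seq (dw1 w) T" and F: "finite F" "\<And>i. i \<in> F \<Longrightarrow> X i \<in> dw1 w"
  shows "T (\<lambda>k. \<Sum>i\<in>F. a i * X i k) = (\<lambda>k. \<Sum>i\<in>F. a i * T (X i) k)"
proof
  fix k
  have "linear_functional_on (dw1 w) (\<lambda>x. T x k)"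
    using T by (simp add: linear_functional_on_def linear_on_seq_def)
  then show "T (\<lambda>k. \<Sum>i\<in>F. a i * X i k) k = (\<Sum>i\<in>F. a i * T (X i) k)"
    by (rule functional_sum) (use F in auto)
qed

lemma bounded_functional_bound:
  assumes "bounded_functional w f"
  obtains C where "C \<ge> 0" "\<And>x. x \<in> dw1 w \<Longrightarrow> \<bar>f x\<bar> \<le> C * lorentz_norm w x"
proof -
  obtain C where C: "\<And>x. x \<in> dw1 w \<Longrightarrow> \<bar>f x\<bar> \<le> C * lorentz_norm w x"
    using assms by (auto simp: bounded_functional_def)
  have "C \<ge> 0" using C[OF unit_in_dw1[of 0]] norm_unit[of 0] by simp
  then show ?thesis using that C by blast
qed

lemma weakly_null_coord:
  assumes "weakly_null w xs"
  shows "(\<lambda>n. xs n k) \<longlonglongrightarrow> 0"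
proof -
  have "bounded_functional w (\<lambda>x. x k)"
    unfolding bounded_functional_def linear_functional_on_def
    using abs_le_norm by (auto intro!: exI[of _ 1])
  then show ?thesis using assms unfolding weakly_null_def by blast
qed

text \<open>The means of a null sequence tend to zero. The strict inequality excludes
  \<open>m = 0\<close>.\<close>

lemma w_average_small:
  assumes "\<epsilon> > 0"
  obtains m where "(\<Sum>i<m. w i) < \<epsilon> * real m"
proof -
  obtain N where N: "\<And>n. n \<ge> N \<Longrightarrow> w n < \<epsilon>/2"
    using order_tendstoD(2)[OF w_tendsto, of "\<epsilon>/2"] assms by (auto simp: eventually_sequentially)
  have le: "(\<Sum>i<N + j. w i) \<le> N + j * (\<epsilon>/2)" for j
  proof (induction j)
    case 0
    show ?case using sum_mono[of "{..<N}" w "\<lambda>_. 1"] w_le_one by simp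
  next
    case (Suc j)
    then show ?case using N[of "N + j"] by (simp add: distrib_right add_divide_distrib)
  qed
  obtain j :: nat where j: "real j > 2 * N / \<epsilon>" using reals_Archimedean2 by blast
  have "real N < j * (\<epsilon>/2)" using j assms by (simp add: field_simps)
  then have "(\<Sum>i<N + j. w i) < j * (\<epsilon>/2) + j * (\<epsilon>/2)" using le[of j] by linarith
  also have "\<dots> = \<epsilon> * real j" by simp
  also have "\<dots> \<le> \<epsilon> * real (N + j)" using assms by simp
  finally show ?thesis by (rule that)
qed

lemma norm_unit_sum:
  assumes A: "finite A" and a: "\<And>k. k \<in> A \<Longrightarrow> \<bar>a k\<bar> \<le> 1"
  shows "lorentz_norm w (\<lambda>k. \<Sum>n\<in>A. a n * unit_seq n k) \<le> (\<Sum>i<card A. w i)"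
proof (rule norm_leI)
  let ?x = "\<lambda>k. \<Sum>n\<in>A. a n * unit_seq n k"
  have x: "?x k = (if k \<in> A then a k else 0)" for k
    using A by (simp add: unit_seq_def if_distrib cong: if_cong)
  show "?x \<longlonglongrightarrow> 0"
    by (intro dw1_tendsto dw1_sum A unit_in_dw1)
  fix B \<pi> assume pl: "placement 0 B \<pi>"
  then have fin: "finite B" and inj: "inj_on \<pi> (B \<inter> A)"
    by (auto simp: placement_def intro: inj_on_subset)
  have "wsum w B \<pi> ?x = (\<Sum>k\<in>B. if k \<in> A then w (\<pi> k) * \<bar>a k\<bar> else 0)"
    unfolding wsum_def x by (intro sum.cong) auto
  also have "\<dots> = (\<Sum>k\<in>B \<inter> A. w (\<pi> k) * \<bar>a k\<bar>)" using fin by (simp add: sum.inter_restrict)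
  also have "\<dots> \<le> (\<Sum>k\<in>B \<inter> A. w (\<pi> k) * 1)"
    using a w_nonneg by (intro sum_mono mult_left_mono) auto
  also have "\<dots> = sum w (\<pi> ` (B \<inter> A))" by (simp add: sum.reindex[OF inj])
  also have "\<dots> \<le> sum w {..<card (\<pi> ` (B \<inter> A))}"
    using fin by (intro sum_decseq_le_initial decseq_w) auto
  also have "\<dots> \<le> sum w {..<card A}"
    using card_image[OF inj] card_mono[OF A, of "B \<inter> A"] w_nonneg by (intro sum_mono2) auto
  finally show "wsum w B \<pi> ?x \<le> sum w {..<card A}" .
qed

text \<open>A functional with \<open>\<bar>f (e\<^sub>n)\<bar> \<ge> \<epsilon>\<close> on arbitrarily large sets \<open>A\<close> would be at least \<open>\<epsilon> * card A\<close>
  on a vector of norm \<open>\<Sum>i<card A. w i\<close>, which is \<open>o(card A)\<close> because \<open>w\<close> tends to zero.\<close>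

lemma unit_weakly_null: "weakly_null w unit_seq"
  unfolding weakly_null_def
proof (intro conjI allI impI unit_in_dw1)
  fix f assume f: "bounded_functional w f"
  then have lin: "linear_functional_on (dw1 w) f" by (simp add: bounded_functional_def)
  obtain C where C: "C \<ge> 0" "\<And>x. x \<in> dw1 w \<Longrightarrow> \<bar>f x\<bar> \<le> C * lorentz_norm w x"
    using bounded_functional_bound[OF f] by blast
  show "(\<lambda>n. f (unit_seq n)) \<longlonglongrightarrow> 0"
  proof (rule LIMSEQ_I, rule ccontr)
    fix \<epsilon> :: real assume e: "\<epsilon> > 0" and neg: "\<not> (\<exists>N. \<forall>n\<ge>N. norm (f (unit_seq n) - 0) < \<epsilon>)"
    define S where "S = {n. \<epsilon> \<le> \<bar>f (unit_seq n)\<bar>}"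
    have "infinite S" unfolding infinite_nat_iff_unbounded_le S_def using neg by (force simp: not_less)
    obtain m where m: "(\<Sum>i<m. w i) < \<epsilon> / (C + 1) * real m"
      using w_average_small[of "\<epsilon> / (C + 1)"] e C(1) by auto
    obtain A where A: "finite A" "card A = m" "A \<subseteq> S"
      using infinite_arbitrarily_large[OF \<open>infinite S\<close>] by blast
    \<comment> \<open>With these signs nothing cancels: \<open>f ?x\<close> is the sum of the
      \<open>\<bar>f (unit_seq n)\<bar>\<close> over \<open>A\<close>.\<close>
    let ?a = "\<lambda>n. sgn (f (unit_seq n))"
    let ?x = "\<lambda>k. \<Sum>n\<in>A. ?a n * unit_seq n k"
    have x: "?x \<in> dw1 w" "f ?x = (\<Sum>n\<in>A. ?a n * f (unit_seq n))"
      by (simp_all add: functional_sum[OF lin A(1)] dw1_sum[OF A(1)] unit_in_dw1)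
    have "\<epsilon> * real m = (\<Sum>n\<in>A. \<epsilon>)" using A by simp
    also have "\<dots> \<le> (\<Sum>n\<in>A. ?a n * f (unit_seq n))"
      using A(3) by (intro sum_mono) (auto simp: S_def abs_sgn mult.commute)
    also have "\<dots> \<le> C * lorentz_norm w ?x" using C(2)[OF x(1)] x(2) by simp
    also have "\<dots> \<le> C * (\<Sum>i<m. w i)"
      using norm_unit_sum[OF A(1), of ?a] A(2) C(1) by (intro mult_left_mono) (auto simp: sgn_if)
    also have "\<dots> \<le> (C + 1) * (\<Sum>i<m. w i)"
      using w_nonneg by (intro mult_right_mono sum_nonneg) auto
    also have "\<dots> < (C + 1) * (\<epsilon> / (C + 1) * real m)"
      using m C(1) by (intro mult_strict_left_mono) auto
    also have "\<dots> = \<epsilon> * real m" using C(1) by simp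
    finally show False by simp
  qed
qed

text \<open>Composing a bounded functional with \<open>T\<close> gives a bounded functional. The
  hypotheses are those common to \<open>bounded_op\<close> and to the embedding in
  \<open>iso_to_dw1\<close>, since both kinds of map occur.\<close>

lemma weakly_null_image:
  assumes xs: "weakly_null w xs" and T: "T ` dw1 w \<subseteq> dw1 w" "linear_on_seq (dw1 w) T"
    and C: "\<And>x. x \<in> dw1 w \<Longrightarrow> lorentz_norm w (T x) \<le> C * lorentz_norm w x"
  shows "weakly_null w (\<lambda>n. T (xs n))"
  unfolding weakly_null_def
proof (intro conjI allI impI)
  show "T (xs n) \<in> dw1 w" for n using xs T(1) by (auto simp: weakly_null_def)
  fix f assume f: "bounded_functional w f"
  obtain D where D: "D \<ge> 0" "\<And>x. x \<in> dw1 w \<Longrightarrow> \<bar>f x\<bar> \<le> D * lorentz_norm w x"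
    using bounded_functional_bound[OF f] by blast
  have "bounded_functional w (\<lambda>x. f (T x))"
    unfolding bounded_functional_def
  proof (intro conjI exI[of _ "D * C"] ballI)
    show "linear_functional_on (dw1 w) (\<lambda>x. f (T x))"
      unfolding linear_functional_on_def
    proof (intro ballI allI)
      fix x y a b assume "x \<in> dw1 w" "y \<in> dw1 w"
      then have "T (\<lambda>k. a * x k + b * y k) = (\<lambda>k. a * T x k + b * T y k)"
        and "T x \<in> dw1 w" "T y \<in> dw1 w"
        using T by (auto simp: linear_on_seq_def)
      then show "f (T (\<lambda>k. a * x k + b * y k)) = a * f (T x) + b * f (T y)"
        using f linear_functional_onD by (auto simp: bounded_functional_def)
    qed
    fix x assume x: "x \<in> dw1 w"
    then have "\<bar>f (T x)\<bar> \<le> D * lorentz_norm w (T x)" using T(1) D(2) by blast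
    also have "\<dots> \<le> D * (C * lorentz_norm w x)" using C[OF x] D(1) by (intro mult_left_mono)
    finally show "\<bar>f (T x)\<bar> \<le> D * C * lorentz_norm w x" by simp
  qed
  then show "(\<lambda>n. f (T (xs n))) \<longlonglongrightarrow> 0"
    using xs unfolding weakly_null_def by blast
qed

text \<open>Every finite piece of the series is dominated by a placement sum, so it converges
  absolutely and defines a functional of norm at most one. Since \<open>S\<close> may be infinite,
  infinitely many blocks can be glued into one functional.\<close>

lemma
  assumes inj: "inj_on \<pi> S" and c: "\<And>k. k \<in> S \<Longrightarrow> \<bar>c k\<bar> \<le> w (\<pi> k)" "\<And>k. k \<notin> S \<Longrightarrow> c k = 0"
  shows summable_coefficients: "x \<in> dw1 w \<Longrightarrow> summable (\<lambda>k. c k * x k)"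
    and bounded_functional_coefficients: "bounded_functional w (\<lambda>x. \<Sum>k. c k * x k)"
proof -
  have le: "(\<Sum>k<n. \<bar>c k * x k\<bar>) \<le> lorentz_norm w x" if x: "x \<in> dw1 w" for x n
  proof -
    have "(\<Sum>k<n. \<bar>c k * x k\<bar>) = (\<Sum>k\<in>{..<n} \<inter> S. \<bar>c k * x k\<bar>)"
      using c(2) by (intro sum.mono_neutral_right) auto
    also have "\<dots> \<le> wsum w ({..<n} \<inter> S) \<pi> x"
      unfolding wsum_def abs_mult using c(1) by (intro sum_mono mult_right_mono) auto
    also have "\<dots> \<le> lorentz_norm w x"
      using inj by (intro wsum_le_norm[OF x, where p = 0]) (auto simp: placement_def intro: inj_on_subset)
    finally show ?thesis .
  qed
  have abs: "summable (\<lambda>k. \<bar>c k * x k\<bar>)" if "x \<in> dw1 w" for x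
    using le[OF that] by (intro summableI_nonneg_bounded) auto
  show sum: "summable (\<lambda>k. c k * x k)" if "x \<in> dw1 w" for x
    using abs[OF that] by (rule summable_rabs_cancel)
  show "bounded_functional w (\<lambda>x. \<Sum>k. c k * x k)"
    unfolding bounded_functional_def linear_functional_on_def
  proof (intro conjI ballI allI exI[of _ 1])
    fix x y and a b :: real assume "x \<in> dw1 w" "y \<in> dw1 w"
    note s = sum[OF this(1)] sum[OF this(2)]
    have "(\<lambda>k. c k * (a * x k + b * y k)) = (\<lambda>k. a * (c k * x k) + b * (c k * y k))"
      by (auto simp: algebra_simps)
    then show "(\<Sum>k. c k * (a * x k + b * y k)) = a * (\<Sum>k. c k * x k) + b * (\<Sum>k. c k * y k)"
      using suminf_add[OF summable_mult[OF s(1), of a] summable_mult[OF s(2), of b]]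
        suminf_mult[OF s(1), of a] suminf_mult[OF s(2), of b] by simp
  next
    fix x assume x: "x \<in> dw1 w"
    have "\<bar>\<Sum>k. c k * x k\<bar> \<le> (\<Sum>k. \<bar>c k * x k\<bar>)" by (rule summable_rabs[OF abs[OF x]])
    also have "\<dots> \<le> lorentz_norm w x" by (rule suminf_le_const[OF abs[OF x] le[OF x]])
    finally show "\<bar>\<Sum>k. c k * x k\<bar> \<le> 1 * lorentz_norm w x" by simp
  qed
qed

section \<open>Dunford-Pettis operators fix no copy of the space\<close>

lemma dunford_pettis_imp_strictly_singular:
  assumes "dunford_pettis w T"
  shows "dw1_strictly_singular w T"
  unfolding dw1_strictly_singular_def
proof (intro allI impI notI, elim conjE)
  fix Z assume Z: "closed_subspace w Z" "iso_to_dw1 w Z" "iso_on w T Z"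
  obtain J c C where J: "c > 0" "bij_betw J (dw1 w) Z" "linear_on_seq (dw1 w) J"
    "\<And>x. x \<in> dw1 w \<Longrightarrow> c * lorentz_norm w x \<le> lorentz_norm w (J x)"
    "\<And>x. x \<in> dw1 w \<Longrightarrow> lorentz_norm w (J x) \<le> C * lorentz_norm w x"
    using Z(2) unfolding iso_to_dw1_def by blast
  obtain d where d: "d > 0" "\<And>z. z \<in> Z \<Longrightarrow> d * lorentz_norm w z \<le> lorentz_norm w (T z)"
    using Z(3) unfolding iso_on_def by blast
  have JZ: "J x \<in> Z" if "x \<in> dw1 w" for x using J(2) that by (auto simp: bij_betw_def)
  have "J ` dw1 w \<subseteq> dw1 w" using JZ Z(1) by (auto simp: closed_subspace_def)
  then have "weakly_null w (\<lambda>n. J (unit_seq n))"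
    using weakly_null_image[OF unit_weakly_null _ J(3,5)] by blast
  then have lim: "(\<lambda>n. lorentz_norm w (T (J (unit_seq n)))) \<longlonglongrightarrow> 0"
    using assms by (auto simp: dunford_pettis_def)
  have "d * c \<le> lorentz_norm w (T (J (unit_seq n)))" for n
  proof -
    have "d * (c * lorentz_norm w (unit_seq n)) \<le> d * lorentz_norm w (J (unit_seq n))"
      using J(4)[OF unit_in_dw1] d(1) by (intro mult_left_mono) auto
    also have "\<dots> \<le> lorentz_norm w (T (J (unit_seq n)))" by (rule d(2)[OF JZ[OF unit_in_dw1]])
    finally show ?thesis by (simp add: norm_unit)
  qed
  then have "d * c \<le> 0" using LIMSEQ_le_const[OF lim] by blast
  then show False using mult_pos_pos[OF d(1) J(1)] by linarith
qed

section \<open>Gliding humps\<close>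

lemma weakly_null_sum_small:
  assumes "weakly_null w xs" "\<epsilon> > 0"
  obtains n0 where "\<And>n. n \<ge> n0 \<Longrightarrow> (\<Sum>k<N. \<bar>xs n k\<bar>) \<le> \<epsilon>"
proof -
  have "(\<lambda>n. \<Sum>k<N. \<bar>xs n k\<bar>) \<longlonglongrightarrow> (\<Sum>k<N. 0)"
    by (intro tendsto_sum tendsto_rabs_zero weakly_null_coord assms(1))
  then have "eventually (\<lambda>n. (\<Sum>k<N. \<bar>xs n k\<bar>) < \<epsilon>) sequentially"
    using assms(2) by (intro order_tendstoD(2)) auto
  then show ?thesis using that by (auto simp: eventually_sequentially intro: less_imp_le)
qed

text \<open>If infinitely many \<open>xs n\<close> kept a mass above \<open>\<delta>\<close> when placed at arbitrarily late weights, then disjoint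
  blocks \<open>B\<^sub>j\<close> of these vectors could be placed at disjoint, increasing stretches of weights; the
  coefficients so obtained form one bounded functional that stays above \<open>\<delta>/4\<close> on a subsequence.\<close>

lemma gliding_hump:
  assumes xs: "weakly_null w xs" and d: "\<delta> > 0"
  shows "\<exists>p n0. \<forall>n\<ge>n0. \<forall>B \<pi>. placement p B \<pi> \<longrightarrow> wsum w B \<pi> (xs n) \<le> \<delta>"
proof (rule ccontr)
  assume neg: "\<not> ?thesis"
  have big: "\<exists>n B \<pi>. n \<ge> n0 \<and> placement p B \<pi> \<and> \<delta> < wsum w B \<pi> (xs n)" for p n0
    using neg by (meson not_less)
  have xs_dw1: "xs n \<in> dw1 w" for n using xs by (simp add: weakly_null_def)
  \<comment> \<open>\<open>N\<close> and \<open>p\<close> bound the coordinates and weights used by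
    the block. The last clause, available from \<open>small_beyond\<close>, limits what
    \<open>xs n\<close> can collect from any later blocks.\<close>
  define good where "good n B \<pi> N p \<longleftrightarrow> placement 0 B \<pi> \<and> B \<subseteq> {..<N} \<and> \<pi> ` B \<subseteq> {..<p} \<and>
    \<delta>/2 \<le> wsum w B \<pi> (xs n) \<and> (\<forall>B' \<pi>'. placement p B' \<pi>' \<longrightarrow> wsum w B' \<pi>' (xs n) \<le> \<delta>/8)"
    for n B \<pi> and N p :: nat
  \<comment> \<open>The new block avoids all earlier coordinates and weights, and the mass of the
    new vector on the earlier coordinates is small, which limits what it collects from earlier
    blocks.\<close>
  define step where "step n N p n' B' \<pi>' N' p' \<longleftrightarrow> n < n' \<and> N \<le> N' \<and> p \<le> p' \<and> B' \<subseteq> {N..} \<and>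
    placement p B' \<pi>' \<and> (\<Sum>k<N. \<bar>xs n' k\<bar>) \<le> \<delta>/8"
    for n N p n' N' p' :: nat and B' and \<pi>' :: "nat \<Rightarrow> nat"
  have ex: "\<exists>n' B' \<pi>' N' p'. good n' B' \<pi>' N' p' \<and> step n N p n' B' \<pi>' N' p'" for n N p
  proof -
    obtain n0 where n0: "\<And>n. n \<ge> n0 \<Longrightarrow> (\<Sum>k<N. \<bar>xs n k\<bar>) \<le> \<delta>/8"
      using weakly_null_sum_small[OF xs, of "\<delta>/8"] d by auto
    obtain n' B \<pi> where n': "n' \<ge> max n0 (Suc n)" "placement p B \<pi>" "\<delta> < wsum w B \<pi> (xs n')"
      using big by blast
    have small: "(\<Sum>k<N. \<bar>xs n' k\<bar>) \<le> \<delta>/8" using n0 n'(1) by simp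
    \<comment> \<open>Removing the coordinates below \<open>N\<close> costs at most
      \<open>\<delta>/8\<close> of a mass above \<open>\<delta>\<close>, so at least
      \<open>\<delta>/2\<close> remains.\<close>
    define B' where "B' = B \<inter> {N..}"
    have finB: "finite B" using n'(2) by (simp add: placement_def)
    have pl: "placement p B' \<pi>" using placement_subset[OF n'(2)] by (simp add: B'_def)
    have "wsum w (B \<inter> {..<N}) \<pi> (xs n') \<le> (\<Sum>k\<in>B \<inter> {..<N}. 1 * \<bar>xs n' k\<bar>)"
      unfolding wsum_def using w_le_one by (intro sum_mono mult_right_mono) auto
    also have "\<dots> \<le> (\<Sum>k<N. \<bar>xs n' k\<bar>)" using finB by (simp add: sum_mono2)
    finally have "wsum w (B \<inter> {..<N}) \<pi> (xs n') \<le> \<delta>/8" using small by simp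
    moreover have "wsum w ((B \<inter> {..<N}) \<union> B') \<pi> (xs n')
        = wsum w (B \<inter> {..<N}) \<pi> (xs n') + wsum w B' \<pi> (xs n')"
      unfolding B'_def using finB by (intro wsum_union) auto
    moreover have "(B \<inter> {..<N}) \<union> B' = B" by (auto simp: B'_def)
    ultimately have half: "\<delta>/2 \<le> wsum w B' \<pi> (xs n')" using n'(3) d by simp
    obtain p1 where p1: "\<And>q B \<pi>. q \<ge> p1 \<Longrightarrow> placement q B \<pi> \<Longrightarrow> wsum w B \<pi> (xs n') \<le> \<delta>/8"
      using small_beyond[OF xs_dw1, of "\<delta>/8"] d by auto
    obtain N1 where N1: "B' \<subseteq> {..<N1}"
      using finite_nat_bounded[of B'] finB by (auto simp: B'_def)
    obtain p2 where p2: "\<pi> ` B' \<subseteq> {..<p2}"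
      using finite_nat_bounded[of "\<pi> ` B'"] finB by (auto simp: B'_def)
    have "good n' B' \<pi> (max N N1) (max p (max p1 p2))"
      unfolding good_def
    proof (intro conjI allI impI)
      show "placement 0 B' \<pi>" using placement_mono[OF pl] by simp
      show "B' \<subseteq> {..<max N N1}" using N1 by auto
      show "\<pi> ` B' \<subseteq> {..<max p (max p1 p2)}" using p2 by fastforce
      fix B'' \<pi>'' assume "placement (max p (max p1 p2)) B'' \<pi>''"
      then show "wsum w B'' \<pi>'' (xs n') \<le> \<delta>/8" by (rule p1[rotated]) simp
    qed (rule half)
    moreover have "step n N p n' B' \<pi> (max N N1) (max p (max p1 p2))"
      unfolding step_def using n'(1) pl small by (auto simp: B'_def)
    ultimately show ?thesis by blast
  qed
  have "\<exists>s. \<forall>j. (\<lambda>(n, B, \<pi>, N, p). good n B \<pi> N p) (s j) \<and>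
    (\<lambda>(n, B, \<pi>, N, p) (n', B', \<pi>', N', p'). step n N p n' B' \<pi>' N' p') (s j) (s (Suc j))"
    by (rule dependent_nat_choice) (use ex in fastforce)+
  then obtain s where s: "\<forall>j. (\<lambda>(n, B, \<pi>, N, p). good n B \<pi> N p) (s j) \<and>
    (\<lambda>(n, B, \<pi>, N, p) (n', B', \<pi>', N', p'). step n N p n' B' \<pi>' N' p') (s j) (s (Suc j))"
    by (rule exE)
  define n where "n j = fst (s j)" for j
  define B where "B j = fst (snd (s j))" for j
  define \<pi> where "\<pi> j = fst (snd (snd (s j)))" for j
  define N where "N j = fst (snd (snd (snd (s j))))" for j
  define p where "p j = snd (snd (snd (snd (s j))))" for j
  have good: "good (n j) (B j) (\<pi> j) (N j) (p j)" for j
    using s[rule_format, of j] by (simp add: n_def B_def \<pi>_def N_def p_def case_prod_beta)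
  have step: "step (n j) (N j) (p j) (n (Suc j)) (B (Suc j)) (\<pi> (Suc j)) (N (Suc j)) (p (Suc j))" for j
    using s[rule_format, of j] by (simp add: n_def B_def \<pi>_def N_def p_def case_prod_beta)
  have mono_N: "N i \<le> N j" and mono_p: "p i \<le> p j" if "i \<le> j" for i j
    using that step lift_Suc_mono_le[of N i j] lift_Suc_mono_le[of p i j] by (auto simp: step_def)
  have mono_n: "strict_mono n" using step by (auto simp: strict_mono_Suc_iff step_def)
  have upper: "k < N i" "\<pi> i k < p i" if "k \<in> B i" for i k
    using good[of i] that by (auto simp: good_def)
  have lower: "N i \<le> k" "p i \<le> \<pi> j k" if "k \<in> B j" "i < j" for i j k
  proof -
    obtain j' where j': "j = Suc j'" "i \<le> j'" using \<open>i < j\<close> by (cases j) auto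
    have "N j' \<le> k" "p j' \<le> \<pi> j k"
      using step[of j'] that(1) j'(1) by (auto simp: step_def placement_def)
    then show "N i \<le> k" "p i \<le> \<pi> j k" using mono_N[OF j'(2)] mono_p[OF j'(2)] by auto
  qed
  have uniq: "i = j" if "k \<in> B i" "k \<in> B j" for i j k
    using upper(1)[OF that(1)] upper(1)[OF that(2)] lower(1)[OF that(1)] lower(1)[OF that(2)]
    by (metis linorder_neqE_nat not_less)
  define S where "S = (\<Union>j. B j)"
  define blk where "blk k = (SOME j. k \<in> B j)" for k
  have blk: "blk k = j" if "k \<in> B j" for k j
    unfolding blk_def using that uniq by (metis someI_ex)
  \<comment> \<open>Each index keeps the weight given by its own block; as the blocks occupy
    disjoint stretches of weights, this is one injection on all of \<open>S\<close>.\<close>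
  define \<sigma> where "\<sigma> k = \<pi> (blk k) k" for k
  have inj: "inj_on \<sigma> S"
  proof (rule inj_onI)
    fix k l assume "k \<in> S" "l \<in> S" and eq: "\<sigma> k = \<sigma> l"
    then obtain i j where i: "k \<in> B i" and j: "l \<in> B j" by (auto simp: S_def)
    have e: "\<pi> i k = \<pi> j l" using eq blk[OF i] blk[OF j] by (simp add: \<sigma>_def)
    have "i = j"
    proof (rule linorder_cases[of i j])
      assume "i < j" then show ?thesis using lower(2)[OF j] upper(2)[OF i] e by fastforce
    next
      assume "j < i" then show ?thesis using lower(2)[OF i] upper(2)[OF j] e by fastforce
    qed
    then show "k = l" using e i j good[of i] by (auto simp: good_def placement_def dest: inj_onD)
  qed
  \<comment> \<open>On each block the signs are those of the vector the block was chosen for, so the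
    block's share of \<open>f\<close> at that vector is exactly its \<open>wsum\<close>.\<close>
  define c where "c k = (if k \<in> S then w (\<sigma> k) * sgn (xs (n (blk k)) k) else 0)" for k
  have c_le: "\<bar>c k\<bar> \<le> w (\<sigma> k)" for k
    using w_nonneg by (auto simp: c_def abs_mult sgn_if)
  have c_le1: "\<bar>c k\<bar> \<le> 1" for k using c_le[of k] w_le_one[of "\<sigma> k"] by simp
  have c_out: "c k = 0" if "k \<notin> S" for k using that by (simp add: c_def)
  define f where "f x = (\<Sum>k. c k * x k)" for x
  have "bounded_functional w f"
    unfolding f_def by (rule bounded_functional_coefficients[OF inj c_le c_out])
  then have "(\<lambda>m. f (xs m)) \<longlonglongrightarrow> 0" using xs by (simp add: weakly_null_def)
  then have lim: "(\<lambda>j. f (xs (n (Suc j)))) \<longlonglongrightarrow> 0"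
    using LIMSEQ_subseq_LIMSEQ[of "\<lambda>m. f (xs m)" 0 "\<lambda>j. n (Suc j)"] mono_n
    by (simp add: comp_def strict_mono_def)
  \<comment> \<open>Only successors were chosen with small mass on the earlier coordinates, hence
    \<open>Suc j\<close>. The vector's own block gives at least \<open>\<delta>/2\<close>; the
    coordinates below \<open>N j\<close> and the later blocks take away at most
    \<open>\<delta>/8\<close> each.\<close>
  have "\<delta>/4 \<le> f (xs (n (Suc j)))" for j
  proof -
    define x where "x = xs (n (Suc j))"
    define A where "A = B (Suc j)"
    have x: "x \<in> dw1 w" unfolding x_def by (rule xs_dw1)
    have lim: "(\<lambda>K. \<Sum>k<K. c k * x k) \<longlonglongrightarrow> f x"
      unfolding f_def by (rule summable_LIMSEQ[OF summable_coefficients[OF inj c_le c_out x]])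
    have "\<delta>/4 \<le> (\<Sum>k<K. c k * x k)" if K: "K \<ge> N (Suc j)" for K
    proof -
      define R where "R = {..<K} - A"
      define R1 where "R1 = R \<inter> {..<N j}"
      define R2 where "R2 = (R - {..<N j}) \<inter> S"
      have "A \<subseteq> {..<K}" using upper(1)[of _ "Suc j"] K by (fastforce simp: A_def)
      then have "(\<Sum>k<K. c k * x k) = (\<Sum>k\<in>A. c k * x k) + (\<Sum>k\<in>R. c k * x k)"
        unfolding R_def by (simp add: sum.subset_diff)
      moreover have "(\<Sum>k\<in>A. c k * x k) = wsum w A (\<pi> (Suc j)) x"
        unfolding wsum_def
      proof (rule sum.cong[OF refl])
        fix k assume k: "k \<in> A"
        then have "k \<in> S" "blk k = Suc j" using blk by (auto simp: S_def A_def)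
        then show "c k * x k = w (\<pi> (Suc j) k) * \<bar>x k\<bar>"
          by (simp add: c_def \<sigma>_def x_def abs_sgn mult.commute mult.left_commute)
      qed
      moreover have "\<delta>/2 \<le> wsum w A (\<pi> (Suc j)) x"
        using good[of "Suc j"] by (simp add: good_def A_def x_def)
      moreover have "- (\<Sum>k\<in>R. c k * x k) \<le> \<delta>/4"
      proof -
        have finR: "finite R" by (simp add: R_def)
        have "- (\<Sum>k\<in>R. c k * x k) \<le> (\<Sum>k\<in>R. \<bar>c k * x k\<bar>)"
          using sum_abs[of "\<lambda>k. c k * x k" R] by linarith
        also have "\<dots> = (\<Sum>k\<in>R1. \<bar>c k * x k\<bar>) + (\<Sum>k\<in>R - {..<N j}. \<bar>c k * x k\<bar>)"
          unfolding R1_def using finR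
          by (subst sum.union_disjoint[symmetric]) (auto intro: sum.cong)
        also have "(\<Sum>k\<in>R - {..<N j}. \<bar>c k * x k\<bar>) = (\<Sum>k\<in>R2. \<bar>c k * x k\<bar>)"
          unfolding R2_def using finR c_out by (intro sum.mono_neutral_right) auto
        also have "(\<Sum>k\<in>R2. \<bar>c k * x k\<bar>) \<le> wsum w R2 \<sigma> x"
          unfolding wsum_def abs_mult using c_le by (intro sum_mono mult_right_mono) auto
        also have "wsum w R2 \<sigma> x \<le> \<delta>/8"
        proof -
          have "p (Suc j) \<le> \<sigma> k" if "k \<in> R2" for k
          proof -
            obtain i where i: "k \<in> B i" using \<open>k \<in> R2\<close> by (auto simp: R2_def S_def)
            have "k \<notin> A" "N j \<le> k" using \<open>k \<in> R2\<close> by (auto simp: R2_def R_def)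
            \<comment> \<open>Blocks up to \<open>j\<close> lie below \<open>N j\<close>, and block
              \<open>Suc j\<close> is \<open>A\<close>. What remains in \<open>R2\<close> thus
              belongs to later blocks, placed at weights from \<open>p (Suc j)\<close> on.\<close>
            have "i > Suc j"
            proof (rule ccontr)
              assume "\<not> Suc j < i"
              then have "i \<le> j" using i \<open>k \<notin> A\<close> by (metis A_def le_SucE not_less)
              then show False using upper(1)[OF i] mono_N[of i j] \<open>N j \<le> k\<close> by simp
            qed
            then show ?thesis using lower(2)[OF i] blk[OF i] by (simp add: \<sigma>_def)
          qed
          then have "placement (p (Suc j)) R2 \<sigma>"
            using finR inj by (auto simp: placement_def R2_def intro: inj_on_subset)
          then show ?thesis using good[of "Suc j"] by (simp add: good_def x_def)
        qed
        also have "(\<Sum>k\<in>R1. \<bar>c k * x k\<bar>) \<le> (\<Sum>k\<in>R1. 1 * \<bar>x k\<bar>)"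
          unfolding abs_mult using c_le1 by (intro sum_mono mult_right_mono) auto
        also have "\<dots> \<le> (\<Sum>k<N j. \<bar>x k\<bar>)" by (simp add: R1_def sum_mono2)
        also have "\<dots> \<le> \<delta>/8" using step[of j] by (simp add: step_def x_def)
        finally show ?thesis by simp
      qed
      ultimately show ?thesis by simp
    qed
    then show ?thesis unfolding x_def[symmetric] using LIMSEQ_le_const[OF lim] by blast
  qed
  then have "\<delta>/4 \<le> 0" using LIMSEQ_le_const[OF lim] by blast
  then show False using d by simp
qed

section \<open>Subspaces spanned by subsequences of the unit vectors\<close>

lemma
  assumes z: "z \<in> dw1 w" and \<kappa>: "strict_mono \<kappa>"
  shows subseq_in_dw1: "(\<lambda>j. z (\<kappa> j)) \<in> dw1 w"
    and norm_subseq_le: "lorentz_norm w (\<lambda>j. z (\<kappa> j)) \<le> lorentz_norm w z"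
proof -
  have inj: "inj \<kappa>" using \<kappa> by (rule strict_mono_imp_inj_on)
  have lim: "(\<lambda>j. z (\<kappa> j)) \<longlonglongrightarrow> 0"
    using LIMSEQ_subseq_LIMSEQ[OF dw1_tendsto[OF z] \<kappa>] by (simp add: comp_def)
  have "wsum w B \<pi> (\<lambda>j. z (\<kappa> j)) \<le> lorentz_norm w z" if pl: "placement 0 B \<pi>" for B \<pi>
  proof -
    have injB: "inj_on \<kappa> B" using inj by (rule inj_on_subset) simp
    have "wsum w B \<pi> (\<lambda>j. z (\<kappa> j)) = wsum w (\<kappa> ` B) (\<pi> \<circ> inv \<kappa>) z"
      unfolding wsum_def by (simp add: sum.reindex[OF injB] inj)
    also have "\<dots> \<le> lorentz_norm w z"
      using pl inj by (intro wsum_le_norm[OF z, where p = 0]) (auto simp: placement_def inj_on_def)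
    finally show ?thesis .
  qed
  then show "(\<lambda>j. z (\<kappa> j)) \<in> dw1 w" "lorentz_norm w (\<lambda>j. z (\<kappa> j)) \<le> lorentz_norm w z"
    using dw1I[OF lim] norm_leI[OF lim] by blast+
qed

text \<open>Placements for the spread sequence pull back along \<open>\<kappa>\<close>, which gives
  one inequality; conversely \<open>x\<close> is the subsequence of \<open>spread \<kappa> x\<close>
  along \<open>\<kappa>\<close>.\<close>

lemma
  assumes x: "x \<in> dw1 w" and \<kappa>: "strict_mono \<kappa>"
  shows spread_in_dw1: "spread \<kappa> x \<in> dw1 w"
    and norm_spread: "lorentz_norm w (spread \<kappa> x) = lorentz_norm w x"
proof -
  have inj: "inj \<kappa>" using \<kappa> by (rule strict_mono_imp_inj_on)
  have lim: "spread \<kappa> x \<longlonglongrightarrow> 0"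
  proof (rule LIMSEQ_I)
    fix r :: real assume r: "r > 0"
    obtain N where N: "\<And>j. j \<ge> N \<Longrightarrow> \<bar>x j\<bar> < r"
      using LIMSEQ_D[OF dw1_tendsto[OF x] r] by auto
    have "\<bar>spread \<kappa> x i\<bar> < r" if "i \<ge> \<kappa> N" for i
    proof (cases "i \<in> range \<kappa>")
      case True
      then obtain j where "i = \<kappa> j" by blast
      then show ?thesis using N[of j] that \<kappa> inj by (simp add: strict_mono_less_eq)
    qed (use r in \<open>simp add: spread_def\<close>)
    then show "\<exists>n0. \<forall>n\<ge>n0. norm (spread \<kappa> x n - 0) < r" by auto
  qed
  have le: "wsum w B \<pi> (spread \<kappa> x) \<le> lorentz_norm w x" if pl: "placement 0 B \<pi>" for B \<pi>
  proof -
    define A where "A = \<kappa> -` B"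
    have finA: "finite A" using pl inj by (auto simp: A_def placement_def intro: finite_vimageI)
    have injA: "inj_on \<kappa> A" using inj by (rule inj_on_subset) simp
    have "wsum w B \<pi> (spread \<kappa> x) = wsum w (\<kappa> ` A) \<pi> (spread \<kappa> x)"
      unfolding wsum_def using pl
      by (intro sum.mono_neutral_right) (auto simp: placement_def A_def spread_def)
    also have "\<dots> = wsum w A (\<pi> \<circ> \<kappa>) x"
      unfolding wsum_def by (simp add: sum.reindex[OF injA] inj)
    also have "\<dots> \<le> lorentz_norm w x"
      using pl finA inj
      by (intro wsum_le_norm[OF x, where p = 0]) (auto simp: placement_def A_def inj_on_def)
    finally show ?thesis .
  qed
  show s: "spread \<kappa> x \<in> dw1 w" using dw1I[OF lim] le by blast
  have "lorentz_norm w (spread \<kappa> x) \<le> lorentz_norm w x" using norm_leI[OF lim] le by blast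
  moreover have "lorentz_norm w x \<le> lorentz_norm w (spread \<kappa> x)"
    using norm_subseq_le[OF s \<kappa>] inj by simp
  ultimately show "lorentz_norm w (spread \<kappa> x) = lorentz_norm w x" by simp
qed

lemma
  fixes \<kappa> :: "nat \<Rightarrow> nat"
  assumes \<kappa>: "strict_mono \<kappa>"
  defines "Z \<equiv> {x \<in> dw1 w. \<forall>k. k \<notin> range \<kappa> \<longrightarrow> x k = 0}"
  shows closed_subspace_supported: "closed_subspace w Z"
    and iso_to_dw1_supported: "iso_to_dw1 w Z"
proof -
  have inj: "inj \<kappa>" using \<kappa> by (rule strict_mono_imp_inj_on)
  show "closed_subspace w Z"
    unfolding closed_subspace_def
  proof (intro conjI ballI allI impI)
    show "(\<lambda>k. a * x k + b * y k) \<in> Z" if "x \<in> Z" "y \<in> Z" for x y a b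
      using that dw1_lincomb by (auto simp: Z_def)
    fix zs z
    assume "(\<forall>n. zs n \<in> Z) \<and> z \<in> dw1 w \<and> (\<lambda>n. lorentz_norm w (\<lambda>k. zs n k - z k)) \<longlonglongrightarrow> 0"
    then have zs: "\<And>n. zs n \<in> Z" and z: "z \<in> dw1 w"
      and lim: "(\<lambda>n. lorentz_norm w (\<lambda>k. zs n k - z k)) \<longlonglongrightarrow> 0" by auto
    have "z k = 0" if k: "k \<notin> range \<kappa>" for k
    proof -
      have "\<bar>z k\<bar> \<le> lorentz_norm w (\<lambda>k. zs n k - z k)" for n
      proof -
        have "(\<lambda>k. zs n k - z k) \<in> dw1 w"
          using dw1_lincomb[OF _ z, of "zs n" 1 "-1"] zs[of n] by (simp add: Z_def)
        from abs_le_norm[OF this, of k] show ?thesis using zs[of n] k by (simp add: Z_def)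
      qed
      then have "\<bar>z k\<bar> \<le> 0" using LIMSEQ_le_const[OF lim] by blast
      then show ?thesis by simp
    qed
    then show "z \<in> Z" using z by (simp add: Z_def)
  qed (auto simp: Z_def zero_in_dw1)
  have "bij_betw (spread \<kappa>) (dw1 w) Z"
  proof (rule bij_betw_byWitness[where f' = "\<lambda>z j. z (\<kappa> j)"])
    show "\<forall>x\<in>dw1 w. (\<lambda>j. spread \<kappa> x (\<kappa> j)) = x" using inj by simp
    show "\<forall>z\<in>Z. spread \<kappa> (\<lambda>j. z (\<kappa> j)) = z"
      by (auto simp: Z_def spread_def f_inv_into_f)
    show "spread \<kappa> ` dw1 w \<subseteq> Z"
      using spread_in_dw1[OF _ \<kappa>] by (auto simp: Z_def spread_def)
    show "(\<lambda>z j. z (\<kappa> j)) ` Z \<subseteq> dw1 w"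
      using subseq_in_dw1[OF _ \<kappa>] by (auto simp: Z_def)
  qed
  moreover have "linear_on_seq (dw1 w) (spread \<kappa>)"
    by (auto simp: linear_on_seq_def spread_def)
  ultimately show "iso_to_dw1 w Z"
    unfolding iso_to_dw1_def using norm_spread[OF _ \<kappa>]
    by (intro exI[of _ "spread \<kappa>"] exI[of _ 1]) auto
qed

section \<open>Operators whose values at the unit vectors do not tend to zero\<close>

lemma bounded_op_bound:
  assumes "bounded_op w T"
  obtains C where "C \<ge> 0" "\<And>x. x \<in> dw1 w \<Longrightarrow> lorentz_norm w (T x) \<le> C * lorentz_norm w x"
proof -
  obtain C where C: "\<And>x. x \<in> dw1 w \<Longrightarrow> lorentz_norm w (T x) \<le> C * lorentz_norm w x"
    using assms by (auto simp: bounded_op_def)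
  have "T (unit_seq 0) \<in> dw1 w" using assms unit_in_dw1 by (auto simp: bounded_op_def)
  then have "C \<ge> 0" using C[OF unit_in_dw1[of 0]] norm_unit[of 0] norm_nonneg by fastforce
  then show ?thesis using that C by blast
qed

text \<open>The lower bound is read off the coordinates \<open>\<mu> j\<close> of \<open>T x\<close>: there \<open>T\<close> is a matrix with
  diagonal at least \<open>\<epsilon>\<close> whose off-diagonal part has total mass at most \<open>\<epsilon>/2\<close>.\<close>

lemma diagonal_lower_bound:
  fixes a :: "nat \<Rightarrow> real"
  assumes T: "bounded_op w T" and e: "\<epsilon> > 0" and \<kappa>: "inj \<kappa>" and \<mu>: "inj \<mu>"
    and diag: "\<And>j. \<epsilon> \<le> \<bar>T (unit_seq (\<kappa> j)) (\<mu> j)\<bar>"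
    and off: "\<And>i j. i \<noteq> j \<Longrightarrow> \<bar>T (unit_seq (\<kappa> i)) (\<mu> j)\<bar> \<le> \<epsilon>/8 * ((1/2) ^ i * (1/2) ^ j)"
    and F: "finite F"
  defines "x \<equiv> (\<lambda>k. \<Sum>j\<in>F. a j * unit_seq (\<kappa> j) k)"
  shows "lorentz_norm w x \<le> 2/\<epsilon> * lorentz_norm w (T x)"
proof -
  have lin: "linear_on_seq (dw1 w) T" using T by (simp add: bounded_op_def)
  have x: "x \<in> dw1 w" unfolding x_def by (intro dw1_sum F unit_in_dw1)
  have Tx: "T x \<in> dw1 w" using T x by (auto simp: bounded_op_def)
  have Tx_eq: "T x k = (\<Sum>i\<in>F. a i * T (unit_seq (\<kappa> i)) k)" for k
    unfolding x_def using linear_on_seq_sum[OF lin F, of "\<lambda>i. unit_seq (\<kappa> i)" a] unit_in_dw1 by simp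
  have x_\<kappa>: "x (\<kappa> j) = a j" if "j \<in> F" for j
  proof -
    have "x (\<kappa> j) = (\<Sum>i\<in>F. if j = i then a i else 0)"
      unfolding x_def unit_seq_def using \<kappa> by (intro sum.cong) (auto simp: inj_eq)
    then show ?thesis using F that by simp
  qed
  have x_out: "x k = 0" if "k \<notin> \<kappa> ` F" for k
    unfolding x_def unit_seq_def using that by (intro sum.neutral) auto
  let ?nx = "lorentz_norm w x"
  have nx: "0 \<le> ?nx" by (rule norm_nonneg[OF x])
  \<comment> \<open>Summing the off-diagonal bound over \<open>i\<close> keeps the factor
    \<open>(1/2) ^ j\<close>, so summing over \<open>j\<close> as well leaves
    \<open>?nx * (\<epsilon>/2)\<close>, which is absorbed into the left side at the end.\<close>
  have coord: "\<epsilon> * \<bar>a j\<bar> \<le> \<bar>T x (\<mu> j)\<bar> + ?nx * (\<epsilon>/4 * (1/2) ^ j)" if j: "j \<in> F" for j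
  proof -
    have "\<bar>\<Sum>i\<in>F - {j}. a i * T (unit_seq (\<kappa> i)) (\<mu> j)\<bar> 
        \<le> (\<Sum>i\<in>F - {j}. ?nx * (\<epsilon>/8 * ((1/2) ^ i * (1/2) ^ j)))"
    proof (rule order_trans[OF sum_abs sum_mono])
      fix i assume i: "i \<in> F - {j}"
      then have "\<bar>a i\<bar> \<le> ?nx" using abs_le_norm[OF x, of "\<kappa> i"] x_\<kappa> by simp
      then show "\<bar>a i * T (unit_seq (\<kappa> i)) (\<mu> j)\<bar> \<le> ?nx * (\<epsilon>/8 * ((1/2) ^ i * (1/2) ^ j))"
        unfolding abs_mult using off[of i j] i nx by (intro mult_mono) auto
    qed
    also have "\<dots> = ?nx * (\<epsilon>/8 * (1/2) ^ j) * (\<Sum>i\<in>F - {j}. (1/2) ^ i)"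
      by (simp add: sum_distrib_left mult_ac)
    also have "\<dots> \<le> ?nx * (\<epsilon>/8 * (1/2) ^ j) * 2"
      using nx e F by (intro mult_left_mono sum_half_powers_le) auto
    finally have o: "\<bar>\<Sum>i\<in>F - {j}. a i * T (unit_seq (\<kappa> i)) (\<mu> j)\<bar> \<le> ?nx * (\<epsilon>/4 * (1/2) ^ j)"
      by (simp add: mult.left_commute)
    have "T x (\<mu> j) = a j * T (unit_seq (\<kappa> j)) (\<mu> j) + (\<Sum>i\<in>F - {j}. a i * T (unit_seq (\<kappa> i)) (\<mu> j))"
      unfolding Tx_eq using F j by (rule sum.remove)
    then have "\<bar>a j * T (unit_seq (\<kappa> j)) (\<mu> j)\<bar> \<le> \<bar>T x (\<mu> j)\<bar> + ?nx * (\<epsilon>/4 * (1/2) ^ j)"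
      using o by linarith
    moreover have "\<epsilon> * \<bar>a j\<bar> \<le> \<bar>a j * T (unit_seq (\<kappa> j)) (\<mu> j)\<bar>"
      unfolding abs_mult using mult_left_mono[OF diag[of j], of "\<bar>a j\<bar>"] by (simp add: mult.commute)
    ultimately show ?thesis by linarith
  qed
  have "?nx \<le> (lorentz_norm w (T x) + ?nx * (\<epsilon>/2)) / \<epsilon>"
  proof (rule norm_leI[OF dw1_tendsto[OF x]])
    fix B \<pi> assume pl: "placement 0 B \<pi>"
    define G where "G = {j \<in> F. \<kappa> j \<in> B}"
    have G: "finite G" "G \<subseteq> F" using F by (auto simp: G_def)
    have inj\<kappa>: "inj_on \<kappa> G" and inj\<mu>: "inj_on \<mu> G" 
      using \<kappa> \<mu> by (auto intro: inj_on_subset)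
    \<comment> \<open>The weight of coordinate \<open>\<kappa> j\<close> of \<open>x\<close> is
      handed to coordinate \<open>\<mu> j\<close> of \<open>T x\<close>.\<close>
    define \<rho> where "\<rho> = \<pi> \<circ> \<kappa> \<circ> inv \<mu>"
    have "inj_on \<rho> (\<mu> ` G)"
    proof (rule inj_onI, elim imageE)
      fix k l i j assume kl: "\<rho> k = \<rho> l" "k = \<mu> i" "i \<in> G" "l = \<mu> j" "j \<in> G"
      then have "\<pi> (\<kappa> i) = \<pi> (\<kappa> j)" using \<mu> by (simp add: \<rho>_def)
      moreover have "\<kappa> i \<in> B" "\<kappa> j \<in> B" using kl by (auto simp: G_def)
      ultimately have "\<kappa> i = \<kappa> j" using pl unfolding placement_def by (meson inj_onD)
      then show "k = l" using \<kappa> kl by (simp add: inj_eq)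
    qed
    then have \<rho>: "placement 0 (\<mu> ` G) \<rho>" using G(1) by (simp add: placement_def)
    have "wsum w B \<pi> x = wsum w (\<kappa> ` G) \<pi> x"
      unfolding wsum_def
    proof (intro sum.mono_neutral_right ballI)
      fix k assume "k \<in> B - \<kappa> ` G"
      then have "k \<notin> \<kappa> ` F" by (auto simp: G_def)
      then show "w (\<pi> k) * \<bar>x k\<bar> = 0" by (simp add: x_out)
    qed (use pl in \<open>auto simp: placement_def G_def\<close>)
    also have "\<dots> = (\<Sum>j\<in>G. w (\<pi> (\<kappa> j)) * \<bar>a j\<bar>)"
      unfolding wsum_def sum.reindex[OF inj\<kappa>] using x_\<kappa> G(2) by (intro sum.cong) auto
    finally have "\<epsilon> * wsum w B \<pi> x = (\<Sum>j\<in>G. w (\<pi> (\<kappa> j)) * (\<epsilon> * \<bar>a j\<bar>))"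
      by (simp add: sum_distrib_left mult_ac)
    also have "\<dots> \<le> (\<Sum>j\<in>G. w (\<pi> (\<kappa> j)) * (\<bar>T x (\<mu> j)\<bar> + ?nx * (\<epsilon>/4 * (1/2) ^ j)))"
      using coord G(2) w_nonneg by (intro sum_mono mult_left_mono) auto
    also have "\<dots> = (\<Sum>j\<in>G. w (\<pi> (\<kappa> j)) * \<bar>T x (\<mu> j)\<bar>) 
        + (\<Sum>j\<in>G. w (\<pi> (\<kappa> j)) * (?nx * (\<epsilon>/4 * (1/2) ^ j)))"
      by (simp add: distrib_left sum.distrib)
    also have "(\<Sum>j\<in>G. w (\<pi> (\<kappa> j)) * \<bar>T x (\<mu> j)\<bar>) = wsum w (\<mu> ` G) \<rho> (T x)"
      unfolding wsum_def sum.reindex[OF inj\<mu>] \<rho>_def using \<mu> by simp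
    also have "wsum w (\<mu> ` G) \<rho> (T x) \<le> lorentz_norm w (T x)"
      by (rule wsum_le_norm[OF Tx \<rho>])
    also have "(\<Sum>j\<in>G. w (\<pi> (\<kappa> j)) * (?nx * (\<epsilon>/4 * (1/2) ^ j))) 
        \<le> (\<Sum>j\<in>G. 1 * (?nx * (\<epsilon>/4 * (1/2) ^ j)))"
      using nx e w_le_one by (intro sum_mono mult_right_mono) auto
    also have "\<dots> = ?nx * (\<epsilon>/4) * (\<Sum>j\<in>G. (1/2) ^ j)"
      by (simp add: sum_distrib_left mult_ac)
    also have "\<dots> \<le> ?nx * (\<epsilon>/4) * 2"
      using nx e G(1) by (intro mult_left_mono sum_half_powers_le) auto
    finally show "wsum w B \<pi> x \<le> (lorentz_norm w (T x) + ?nx * (\<epsilon>/2)) / \<epsilon>"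
      using e by (simp add: field_simps)
  qed
  then show ?thesis using e by (simp add: field_simps)
qed

lemma strictly_singular_imp_units_tendsto:
  assumes T: "bounded_op w T" and ss: "dw1_strictly_singular w T"
  shows "(\<lambda>n. lorentz_norm w (T (unit_seq n))) \<longlonglongrightarrow> 0"
proof (rule LIMSEQ_I, rule ccontr)
  fix r :: real
  assume r: "r > 0" and neg: "\<not> (\<exists>n0. \<forall>n\<ge>n0. norm (lorentz_norm w (T (unit_seq n)) - 0) < r)"
  have lin: "linear_on_seq (dw1 w) T" and T_dw1: "T ` dw1 w \<subseteq> dw1 w"
    using T by (auto simp: bounded_op_def)
  have Te: "T (unit_seq n) \<in> dw1 w" for n using T_dw1 unit_in_dw1 by blast
  obtain C where C: "C \<ge> 0" "\<And>x. x \<in> dw1 w \<Longrightarrow> lorentz_norm w (T x) \<le> C * lorentz_norm w x"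
    using bounded_op_bound[OF T] by blast
  have wn: "weakly_null w (\<lambda>n. T (unit_seq n))"
    by (rule weakly_null_image[OF unit_weakly_null T_dw1 lin C(2)])
  have often: "\<exists>n\<ge>n0. r \<le> lorentz_norm w (T (unit_seq n))" for n0
    using neg norm_nonneg[OF Te] by (auto simp: not_less)
  obtain p n0 where p: "\<And>n B \<pi>. n \<ge> n0 \<Longrightarrow> placement p B \<pi> \<Longrightarrow> wsum w B \<pi> (T (unit_seq n)) \<le> r/2"
    using gliding_hump[OF wn half_gt_zero[OF r]] by blast
  \<comment> \<open>If all coordinates were below \<open>\<epsilon>\<close>, the first
    \<open>p\<close> weights would contribute at most \<open>r/4\<close> and the later ones at most
    \<open>r/2\<close>, less than \<open>r\<close> in total.\<close>
  define \<epsilon> where "\<epsilon> = r / (4 * (real p + 1))"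
  have e: "\<epsilon> > 0" using r by (simp add: \<epsilon>_def)
  have large: "\<exists>m. \<epsilon> \<le> \<bar>T (unit_seq n) m\<bar>"
    if "n \<ge> n0" "r \<le> lorentz_norm w (T (unit_seq n))" for n
  proof (rule ccontr)
    assume "\<not> ?thesis"
    then have "lorentz_norm w (T (unit_seq n)) \<le> p * \<epsilon> + r/2"
      by (intro norm_le_sup_plus[OF Te] p[OF that(1)]) (auto simp: not_le intro: less_imp_le)
    also have "p * \<epsilon> \<le> (real p + 1) * \<epsilon>" using e by simp
    also have "(real p + 1) * \<epsilon> = r/4" by (simp add: \<epsilon>_def field_simps)
    finally show False using that(2) r by simp
  qed
  have advance: "\<exists>k' m'. k < k' \<and> m < m' \<and> (\<forall>i\<le>m. \<bar>T (unit_seq k') i\<bar> \<le> \<theta>) \<and>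
      (\<forall>i\<le>k. \<bar>T (unit_seq i) m'\<bar> \<le> \<theta>) \<and> \<epsilon> \<le> \<bar>T (unit_seq k') m'\<bar>" if \<theta>: "\<theta> > 0" for k m \<theta>
  proof -
    have "eventually (\<lambda>l. \<bar>T (unit_seq i) l\<bar> < \<theta>) sequentially" for i
      using tendsto_rabs_zero[OF dw1_tendsto[OF Te]] \<theta> by (rule order_tendstoD)
    then have "eventually (\<lambda>l. \<forall>i\<in>{..k}. \<bar>T (unit_seq i) l\<bar> < \<theta>) sequentially"
      by (intro eventually_ball_finite) auto
    then obtain M where M: "\<And>l i. l \<ge> M \<Longrightarrow> i \<le> k \<Longrightarrow> \<bar>T (unit_seq i) l\<bar> < \<theta>"
      by (auto simp: eventually_sequentially)
    \<comment> \<open>From \<open>M\<close> on, the images of the unit vectors up to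
      \<open>k\<close> are below \<open>\<theta>\<close>. A late \<open>k'\<close> makes its own
      image at most \<open>\<epsilon>/2\<close> before \<open>M'\<close>, which forces its
      coordinate of size \<open>\<epsilon>\<close> to \<open>M'\<close> or beyond.\<close>
    define M' where "M' = Suc (max M m)"
    obtain n1 where n1: "\<And>n. n \<ge> n1 \<Longrightarrow> (\<Sum>i<M'. \<bar>T (unit_seq n) i\<bar>) \<le> min \<theta> (\<epsilon>/2)"
      using weakly_null_sum_small[OF wn, of "min \<theta> (\<epsilon>/2)" M'] \<theta> e by auto
    obtain k' where k': "k' \<ge> max n0 (max n1 (Suc k))" "r \<le> lorentz_norm w (T (unit_seq k'))"
      using often by blast
    obtain m' where m': "\<epsilon> \<le> \<bar>T (unit_seq k') m'\<bar>" using large[of k'] k' by auto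
    have small: "\<bar>T (unit_seq k') i\<bar> \<le> min \<theta> (\<epsilon>/2)" if "i < M'" for i
    proof -
      have "\<bar>T (unit_seq k') i\<bar> \<le> (\<Sum>i<M'. \<bar>T (unit_seq k') i\<bar>)"
        using that by (intro member_le_sum) auto
      then show ?thesis using n1[of k'] k' by simp
    qed
    have "M' \<le> m'" using small[of m'] m' e by (cases "m' < M'") auto
    then have "m < m'" "M \<le> m'" by (auto simp: M'_def)
    then show ?thesis
      using k'(1) m' M small by (intro exI[of _ k'] exI[of _ m']) (auto simp: M'_def less_imp_le)
  qed
  \<comment> \<open>One bound per stage must serve all pairs \<open>i \<le> j\<close>:
    \<open>(1/4) ^ j\<close> is at most \<open>(1/2) ^ i * (1/2) ^ j\<close>, and 1/16 instead of
    1/8 pays for the shift from \<open>j\<close> to \<open>Suc j\<close>.\<close>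
  define \<theta> where "\<theta> j = \<epsilon>/16 * (1/4) ^ j" for j
  have \<theta>: "\<theta> j > 0" for j using e by (simp add: \<theta>_def)
  have "\<exists>s. \<forall>j. (\<lambda>(k, m). \<epsilon> \<le> \<bar>T (unit_seq k) m\<bar>) (s j) \<and>
    (\<lambda>(k, m) (k', m'). k < k' \<and> m < m' \<and> (\<forall>i\<le>m. \<bar>T (unit_seq k') i\<bar> \<le> \<theta> j) \<and>
      (\<forall>i\<le>k. \<bar>T (unit_seq i) m'\<bar> \<le> \<theta> j)) (s j) (s (Suc j))"
  proof (rule dependent_nat_choice)
    obtain k where k: "k \<ge> n0" "r \<le> lorentz_norm w (T (unit_seq k))" using often by blast
    obtain m where "\<epsilon> \<le> \<bar>T (unit_seq k) m\<bar>" using large[OF k] by blast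
    then show "\<exists>s. (\<lambda>(k, m). \<epsilon> \<le> \<bar>T (unit_seq k) m\<bar>) s" by (intro exI[of _ "(k, m)"]) simp
    show "\<exists>s'. (\<lambda>(k, m). \<epsilon> \<le> \<bar>T (unit_seq k) m\<bar>) s' \<and>
      (\<lambda>(k, m) (k', m'). k < k' \<and> m < m' \<and> (\<forall>i\<le>m. \<bar>T (unit_seq k') i\<bar> \<le> \<theta> j) \<and>
      (\<forall>i\<le>k. \<bar>T (unit_seq i) m'\<bar> \<le> \<theta> j)) s s'" for s j
      using advance[OF \<theta>[of j], of "fst s" "snd s"] by (cases s) auto
  qed
  then obtain s where s: "\<forall>j. (\<lambda>(k, m). \<epsilon> \<le> \<bar>T (unit_seq k) m\<bar>) (s j) \<and>
    (\<lambda>(k, m) (k', m'). k < k' \<and> m < m' \<and> (\<forall>i\<le>m. \<bar>T (unit_seq k') i\<bar> \<le> \<theta> j) \<and>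
      (\<forall>i\<le>k. \<bar>T (unit_seq i) m'\<bar> \<le> \<theta> j)) (s j) (s (Suc j))"
    by (rule exE)
  define \<kappa> where "\<kappa> j = fst (s j)" for j
  define \<mu> where "\<mu> j = snd (s j)" for j
  have diag: "\<epsilon> \<le> \<bar>T (unit_seq (\<kappa> j)) (\<mu> j)\<bar>"
    and succ: "\<kappa> j < \<kappa> (Suc j)" "\<mu> j < \<mu> (Suc j)"
    and row: "\<And>i. i \<le> \<mu> j \<Longrightarrow> \<bar>T (unit_seq (\<kappa> (Suc j))) i\<bar> \<le> \<theta> j"
    and col: "\<And>i. i \<le> \<kappa> j \<Longrightarrow> \<bar>T (unit_seq i) (\<mu> (Suc j))\<bar> \<le> \<theta> j" for j
    using s[rule_format, of j] by (auto simp: \<kappa>_def \<mu>_def case_prod_beta)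
  have \<kappa>: "strict_mono \<kappa>" and \<mu>: "strict_mono \<mu>"
    using succ by (auto simp: strict_mono_Suc_iff)
  have inj: "inj \<kappa>" "inj \<mu>" using \<kappa> \<mu> by (auto intro: strict_mono_imp_inj_on)
  have \<theta>_le: "\<theta> j \<le> \<epsilon>/8 * ((1/2) ^ i * (1/2) ^ Suc j)" if "i \<le> j" for i j
  proof -
    have "(1/4::real) ^ j = (1/2) ^ j * (1/2) ^ j"
      by (simp add: power_mult_distrib[symmetric])
    also have "\<dots> \<le> (1/2) ^ i * (1/2) ^ j"
      using that by (intro mult_right_mono power_decreasing) auto
    finally have "\<epsilon>/16 * (1/4) ^ j \<le> \<epsilon>/16 * ((1/2) ^ i * (1/2) ^ j)"
      using e by (intro mult_left_mono) auto
    then show ?thesis by (simp add: \<theta>_def)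
  qed
  have off: "\<bar>T (unit_seq (\<kappa> i)) (\<mu> j)\<bar> \<le> \<epsilon>/8 * ((1/2) ^ i * (1/2) ^ j)" if "i \<noteq> j" for i j
  proof (cases "i < j")
    case True
    then obtain j' where j': "j = Suc j'" "i \<le> j'" by (cases j) auto
    have "\<bar>T (unit_seq (\<kappa> i)) (\<mu> j)\<bar> \<le> \<theta> j'"
      unfolding j'(1) using j'(2) \<kappa> by (intro col) (simp add: strict_mono_less_eq)
    then show ?thesis using \<theta>_le[OF j'(2)] j'(1) by simp
  next
    case False
    then obtain i' where i': "i = Suc i'" "j \<le> i'" using \<open>i \<noteq> j\<close> by (cases i) auto
    have "\<bar>T (unit_seq (\<kappa> i)) (\<mu> j)\<bar> \<le> \<theta> i'"
      unfolding i'(1) using i'(2) \<mu> by (intro row) (simp add: strict_mono_less_eq)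
    then show ?thesis using \<theta>_le[OF i'(2)] i'(1) by (simp add: mult.commute)
  qed
  define Z where "Z = {x \<in> dw1 w. \<forall>k. k \<notin> range \<kappa> \<longrightarrow> x k = 0}"
  have lower: "lorentz_norm w x \<le> 2/\<epsilon> * lorentz_norm w (T x)" if xZ: "x \<in> Z" for x
  proof (rule field_le_epsilon)
    fix \<delta> :: real assume d: "\<delta> > 0"
    have x: "x \<in> dw1 w" using xZ by (simp add: Z_def)
    \<comment> \<open>The diagonal estimate covers finite combinations only, so \<open>x\<close> is
      cut into a finite part \<open>u\<close> and a tail \<open>y\<close>. \<open>D\<close> is the
      total factor at the norm of \<open>y\<close>: through \<open>T\<close> and directly.\<close>
    define D where "D = 2/\<epsilon> * C + 1"
    have D: "D > 0" using e C(1) by (auto simp: D_def intro: add_nonneg_pos)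
    obtain N where N: "lorentz_norm w (\<lambda>k. if k < N then 0 else x k) \<le> \<delta> / D"
      using norm_tail_small[OF x, of "\<delta> / D"] d D by auto
    define y where "y = (\<lambda>k. if k < N then 0 else x k)"
    have y: "y \<in> dw1 w" unfolding y_def by (rule dw1_mono[OF x]) auto
    define F where "F = {j. \<kappa> j < N}"
    have "F \<subseteq> {..<N}" unfolding F_def using strict_mono_imp_increasing[OF \<kappa>] by (auto intro: le_less_trans)
    then have F: "finite F" using finite_subset by blast
    define u where "u = (\<lambda>k. \<Sum>j\<in>F. x (\<kappa> j) * unit_seq (\<kappa> j) k)"
    have u: "u \<in> dw1 w" unfolding u_def by (intro dw1_sum F unit_in_dw1)
    have xuy: "x k = u k + y k" for k
    proof (cases "k \<in> range \<kappa>")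
      case True
      then obtain i where i: "k = \<kappa> i" by blast
      have "u k = (\<Sum>j\<in>F. if i = j then x k else 0)"
        unfolding u_def i unit_seq_def using inj(1) by (intro sum.cong) (auto simp: inj_eq)
      then show ?thesis using F i by (simp add: y_def F_def)
    next
      case False
      then have "u k = 0" unfolding u_def unit_seq_def by (intro sum.neutral) auto
      then show ?thesis using False xZ by (simp add: y_def Z_def)
    qed
    have u_le: "lorentz_norm w u \<le> 2/\<epsilon> * lorentz_norm w (T u)"
      unfolding u_def by (rule diagonal_lower_bound[OF T e inj diag off F])
    have "u = (\<lambda>k. 1 * x k + (-1) * y k)" using xuy by auto
    then have Tu: "T u = (\<lambda>k. 1 * T x k + (-1) * T y k)"
      using lin x y unfolding linear_on_seq_def by metis
    have TxTy: "T x \<in> dw1 w" "T y \<in> dw1 w" using T_dw1 x y by auto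
    have "lorentz_norm w (T u) \<le> lorentz_norm w (T x) + lorentz_norm w (T y)"
      unfolding Tu using norm_lincomb[OF TxTy, of 1 "-1"] by simp
    then have "lorentz_norm w (T u) \<le> lorentz_norm w (T x) + C * lorentz_norm w y"
      using C(2)[OF y] by linarith
    then have "2/\<epsilon> * lorentz_norm w (T u) \<le> 2/\<epsilon> * (lorentz_norm w (T x) + C * lorentz_norm w y)"
      using e by (intro mult_left_mono) auto
    with u_le
    have "lorentz_norm w x \<le> 2/\<epsilon> * (lorentz_norm w (T x) + C * lorentz_norm w y) + lorentz_norm w y"
      using norm_triangle[OF u y xuy] by linarith
    also have "\<dots> = 2/\<epsilon> * lorentz_norm w (T x) + D * lorentz_norm w y"
      by (simp add: D_def algebra_simps)
    also have "D * lorentz_norm w y \<le> D * (\<delta> / D)"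
      using N D unfolding y_def by (intro mult_left_mono) auto
    also have "D * (\<delta> / D) = \<delta>" using D by simp
    finally show "lorentz_norm w x \<le> 2/\<epsilon> * lorentz_norm w (T x) + \<delta>" by simp
  qed
  have "iso_on w T Z"
    unfolding iso_on_def
  proof (intro exI[of _ "\<epsilon>/2"] conjI ballI)
    fix z assume "z \<in> Z"
    from lower[OF this] show "\<epsilon>/2 * lorentz_norm w z \<le> lorentz_norm w (T z)"
      using e by (simp add: field_simps)
  qed (use e in simp)
  moreover have "closed_subspace w Z" "iso_to_dw1 w Z"
    unfolding Z_def by (rule closed_subspace_supported[OF \<kappa>] iso_to_dw1_supported[OF \<kappa>])+
  ultimately show False using ss by (auto simp: dw1_strictly_singular_def)
qed

section \<open>Operators whose values at the unit vectors tend to zero\<close>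

lemma weakly_null_bounded:
  assumes "weakly_null w xs"
  obtains M n0 where "M > 0" "\<And>n. n \<ge> n0 \<Longrightarrow> lorentz_norm w (xs n) \<le> M"
proof -
  \<comment> \<open>A single coordinate placed at weight \<open>p\<close> has mass at most 1, so all
    coordinates are at most \<open>1 / w p\<close>; with the late weights under control this bounds
    the norm.\<close>
  obtain p n0 where p: "\<And>n B \<pi>. n \<ge> n0 \<Longrightarrow> placement p B \<pi> \<Longrightarrow> wsum w B \<pi> (xs n) \<le> 1"
    using gliding_hump[OF assms zero_less_one] by blast
  have "lorentz_norm w (xs n) \<le> p * (1 / w p) + 1" if n: "n \<ge> n0" for n
  proof (rule norm_le_sup_plus[OF _ _ p[OF n]])
    show "xs n \<in> dw1 w" using assms by (simp add: weakly_null_def)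
    show "\<bar>xs n k\<bar> \<le> 1 / w p" for k
      using p[OF n placement_single[of p k]] w_pos[of p] by (simp add: field_simps)
  qed
  moreover have "0 < p * (1 / w p) + 1" using w_pos[of p] by (intro add_nonneg_pos) auto
  ultimately show ?thesis using that by blast
qed

text \<open>\<open>Q\<close> coordinates above \<open>\<eta>\<close> force a norm of at least
  \<open>\<eta>\<close> times the sum of the first \<open>Q\<close> weights, and these sums are
  unbounded. The bound is uniform over the ball of radius \<open>M\<close>.\<close>

lemma superlevel_card_le:
  assumes \<eta>: "\<eta> > 0"
  obtains Q where "\<And>x. x \<in> dw1 w \<Longrightarrow> lorentz_norm w x \<le> M \<Longrightarrow> card {k. \<bar>x k\<bar> > \<eta>} \<le> Q"
proof -
  obtain Q where Q: "(\<Sum>i<Q. w i) > M / \<eta>" using w_sums_unbounded by blast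
  have "card {k. \<bar>x k\<bar> > \<eta>} \<le> Q" if x: "x \<in> dw1 w" "lorentz_norm w x \<le> M" for x
  proof (rule ccontr)
    assume "\<not> ?thesis"
    then obtain B where B: "finite B" "card B = Q" "B \<subseteq> {k. \<bar>x k\<bar> > \<eta>}"
      by (metis nat_le_linear obtain_subset_with_card_n)
    obtain \<pi> where \<pi>: "bij_betw \<pi> B {..<Q}"
      using B(1,2) by (metis card_lessThan finite_lessThan finite_same_card_bij)
    have "M < (\<Sum>i<Q. w i) * \<eta>" using Q \<eta> by (simp add: field_simps)
    also have "\<dots> = (\<Sum>k\<in>B. w (\<pi> k) * \<eta>)"
      unfolding sum.reindex_bij_betw[OF \<pi>, of w, symmetric] by (rule sum_distrib_right)
    also have "\<dots> \<le> wsum w B \<pi> x"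
      unfolding wsum_def using B(3) w_nonneg by (intro sum_mono mult_left_mono) auto
    also have "\<dots> \<le> lorentz_norm w x"
      using \<pi> B(1) by (intro wsum_le_norm[OF x(1), where p = 0]) (auto simp: placement_def bij_betw_def)
    finally show False using x(2) by simp
  qed
  then show ?thesis by (rule that)
qed

lemma units_tendsto_imp_dunford_pettis:
  assumes T: "bounded_op w T"
    and lim: "(\<lambda>n. lorentz_norm w (T (unit_seq n))) \<longlonglongrightarrow> 0"
  shows "dunford_pettis w T"
  unfolding dunford_pettis_def
proof (intro allI impI LIMSEQ_I)
  fix xs and r :: real assume wn: "weakly_null w xs" and r: "r > 0"
  have lin: "linear_on_seq (dw1 w) T" and T_dw1: "T ` dw1 w \<subseteq> dw1 w"
    using T by (auto simp: bounded_op_def)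
  have Te: "T (unit_seq n) \<in> dw1 w" for n using T_dw1 unit_in_dw1 by blast
  obtain C where C: "C \<ge> 0" "\<And>x. x \<in> dw1 w \<Longrightarrow> lorentz_norm w (T x) \<le> C * lorentz_norm w x"
    using bounded_op_bound[OF T] by blast
  have xs: "xs n \<in> dw1 w" for n using wn by (simp add: weakly_null_def)
  obtain M n1 where M: "M > 0" "\<And>n. n \<ge> n1 \<Longrightarrow> lorentz_norm w (xs n) \<le> M"
    using weakly_null_bounded[OF wn] by blast
  define c where "c = C + 1"
  have c: "c > 0" "C \<le> c" using C(1) by (simp_all add: c_def)
  \<comment> \<open>The flat remainder \<open>y\<close> will have norm at most
    \<open>2 * \<delta>\<close>, so its image has norm at most \<open>r/4\<close>; \<open>c\<close>
    replaces \<open>C\<close> to keep the divisor positive.\<close>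
  define \<delta> where "\<delta> = r / (8 * c)"
  have d: "\<delta> > 0" using r c by (simp add: \<delta>_def)
  obtain p n2 where p: "\<And>n B \<pi>. n \<ge> n2 \<Longrightarrow> placement p B \<pi> \<Longrightarrow> wsum w B \<pi> (xs n) \<le> \<delta>"
    using gliding_hump[OF wn d] by blast
  define \<eta> where "\<eta> = \<delta> / (real p + 1)"
  have \<eta>: "\<eta> > 0" using d by (simp add: \<eta>_def)
  have p\<eta>: "p * \<eta> \<le> \<delta>" using d by (simp add: \<eta>_def field_simps)
  obtain Q where Q: "\<And>x. x \<in> dw1 w \<Longrightarrow> lorentz_norm w x \<le> M \<Longrightarrow> card {k. \<bar>x k\<bar> > \<eta>} \<le> Q"
    using superlevel_card_le[OF \<eta>] by blast
  define q where "q = real Q + 1"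
  have q: "q > 0" "real Q \<le> q" by (simp_all add: q_def)
  \<comment> \<open>Large coordinates from \<open>K\<close> on number at most \<open>Q\<close> and
    are at most \<open>M\<close> in size, so their images add up to at most
    \<open>q * (M * \<epsilon>)\<close>, which is \<open>r/4\<close>.\<close>
  define \<epsilon> where "\<epsilon> = r / (4 * q * M)"
  have e: "\<epsilon> > 0" using r M(1) q by (simp add: \<epsilon>_def)
  obtain K where K: "\<And>k. k \<ge> K \<Longrightarrow> lorentz_norm w (T (unit_seq k)) < \<epsilon>"
    using order_tendstoD(2)[OF lim e] by (auto simp: eventually_sequentially)
  obtain n3 where n3: "\<And>n. n \<ge> n3 \<Longrightarrow> (\<Sum>k<K. \<bar>xs n k\<bar>) \<le> r / (4 * c)"
    using weakly_null_sum_small[OF wn, of "r / (4 * c)"] r c by auto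
  have "lorentz_norm w (T (xs n)) < r" if n: "n \<ge> max n1 (max n2 n3)" for n
  proof -
    define x where "x = xs n"
    have x: "x \<in> dw1 w" "lorentz_norm w x \<le> M" using xs M(2) n by (auto simp: x_def)
    define A where "A = {k. \<bar>x k\<bar> > \<eta>}"
    have A: "finite A" "card A \<le> Q"
      unfolding A_def using finite_superlevel[OF dw1_tendsto[OF x(1)] \<eta>] Q[OF x] by auto
    define u where "u = (\<lambda>k. \<Sum>i\<in>A. x i * unit_seq i k)"
    define y where "y = (\<lambda>k. if k \<in> A then 0 else x k)"
    have u_eq: "u k = (if k \<in> A then x k else 0)" for k
      unfolding u_def unit_seq_def using A(1) by (simp add: if_distrib cong: if_cong)
    have u: "u \<in> dw1 w" unfolding u_def by (intro dw1_sum A unit_in_dw1)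
    have y: "y \<in> dw1 w" unfolding y_def by (rule dw1_mono[OF x(1)]) auto
    have "lorentz_norm w y \<le> p * \<eta> + \<delta>"
    proof (rule norm_le_sup_plus[OF y])
      show "\<bar>y k\<bar> \<le> \<eta>" for k using \<eta> by (auto simp: y_def A_def)
      fix B \<pi> assume pl: "placement p B \<pi>"
      have "wsum w B \<pi> y \<le> wsum w B \<pi> x"
        unfolding wsum_def y_def by (intro sum_mono mult_left_mono w_nonneg) auto
      also have "\<dots> \<le> \<delta>" unfolding x_def using n by (intro p pl) auto
      finally show "wsum w B \<pi> y \<le> \<delta>" .
    qed
    then have "lorentz_norm w y \<le> 2 * \<delta>" using p\<eta> by simp
    then have "C * lorentz_norm w y \<le> C * (2 * \<delta>)" using C(1) by (intro mult_left_mono)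
    then have Ty: "lorentz_norm w (T y) \<le> C * (2 * \<delta>)" using C(2)[OF y] by simp
    have "C * (2 * \<delta>) \<le> c * (2 * \<delta>)" using d c by simp
    also have "\<dots> = r/4" using c by (simp add: \<delta>_def)
    finally have Ty': "lorentz_norm w (T y) \<le> r/4" using Ty by simp
    \<comment> \<open>Below \<open>K\<close> the images of the unit vectors need not be small, but
      there the coordinates of \<open>x\<close> are; from \<open>K\<close> on it is the other way
      round.\<close>
    let ?t = "\<lambda>i. \<bar>x i\<bar> * lorentz_norm w (T (unit_seq i))"
    have t0: "0 \<le> ?t i" for i using norm_nonneg[OF Te] by simp
    have "lorentz_norm w (T u) \<le> (\<Sum>i\<in>A. ?t i)"
      unfolding u_def linear_on_seq_sum[OF lin A(1) unit_in_dw1] by (rule norm_sum[OF A(1) Te])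
    also have "\<dots> = (\<Sum>i\<in>A \<inter> {..<K}. ?t i) + (\<Sum>i\<in>A - {..<K}. ?t i)"
      using A(1) by (subst sum.union_disjoint[symmetric]) (auto intro: sum.cong)
    also have "(\<Sum>i\<in>A \<inter> {..<K}. ?t i) \<le> (\<Sum>i<K. ?t i)"
      using t0 by (intro sum_mono2) auto
    also have "\<dots> \<le> (\<Sum>i<K. \<bar>x i\<bar> * c)"
    proof (intro sum_mono mult_left_mono)
      show "lorentz_norm w (T (unit_seq i)) \<le> c" for i
        using C(2)[OF unit_in_dw1, of i] c(2) by (simp add: norm_unit)
    qed simp
    also have "\<dots> = (\<Sum>i<K. \<bar>x i\<bar>) * c" by (simp add: sum_distrib_right)
    also have "\<dots> \<le> r / (4 * c) * c"
      unfolding x_def using n3[of n] n c by (intro mult_right_mono) auto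
    also have "\<dots> = r/4" using c by simp
    also have "(\<Sum>i\<in>A - {..<K}. ?t i) \<le> (\<Sum>i\<in>A - {..<K}. M * \<epsilon>)"
    proof (rule sum_mono, rule mult_mono)
      fix i assume "i \<in> A - {..<K}"
      then show "lorentz_norm w (T (unit_seq i)) \<le> \<epsilon>" using K[of i] by simp
      show "\<bar>x i\<bar> \<le> M" using abs_le_norm[OF x(1), of i] x(2) by simp
    qed (use M(1) norm_nonneg[OF Te] in auto)
    also have "\<dots> = card (A - {..<K}) * (M * \<epsilon>)" by simp
    also have "\<dots> \<le> q * (M * \<epsilon>)"
      using A card_mono[of A "A - {..<K}"] q(2) M(1) e by (intro mult_right_mono) auto
    also have "\<dots> = r/4" using M(1) q(1) by (simp add: \<epsilon>_def)
    finally have Tu: "lorentz_norm w (T u) \<le> r/4 + r/4" by simp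
    have "x = (\<lambda>k. 1 * u k + 1 * y k)" by (auto simp: u_eq y_def)
    then have Tx: "T x = (\<lambda>k. 1 * T u k + 1 * T y k)"
      using lin u y unfolding linear_on_seq_def by metis
    have "lorentz_norm w (T x) \<le> lorentz_norm w (T u) + lorentz_norm w (T y)"
      using T_dw1 u y by (intro norm_triangle) (auto simp: Tx)
    then show ?thesis using Tu Ty' r unfolding x_def by linarith
  qed
  then show "\<exists>n0. \<forall>n\<ge>n0. norm (lorentz_norm w (T (xs n)) - 0) < r"
    using norm_nonneg T_dw1 xs by (intro exI[of _ "max n1 (max n2 n3)"]) (auto simp: image_subset_iff)
qed

end

theorem theorem5p7:
  fixes w :: "nat \<Rightarrow> real" and T :: "(nat \<Rightarrow> real) \<Rightarrow> (nat \<Rightarrow> real)"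
  assumes "lorentz_weight w" and "bounded_op w T"
  shows "dw1_strictly_singular w T \<longleftrightarrow> dunford_pettis w T"
proof -
  interpret lorentz_sequence_space w by standard (rule assms(1))
  show ?thesis
    using strictly_singular_imp_units_tendsto[OF assms(2)] units_tendsto_imp_dunford_pettis[OF assms(2)]
      dunford_pettis_imp_strictly_singular by blast
qed

end
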